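(* For every $1\leq\delta<2$, $\alpha_*\big(\big(1-\frac{\delta}{2},1,\delta\big),3\big)\leq 1+\frac{\delta}{2}$.
   Context: Let $G\sim G(n,\frac12)$ be a random graph on a vertex set $V$ with $|V|=n$; logarithms are base 2. An algorithm accesses $G$ only through edge queries: querying an unordered pair $\{u,v\}$ of distinct vertices reveals whether $\{u,v\}$ is an edge of $G$. An $l$-round algorithm is deterministic and proceeds in $l$ rounds; in round $i$ it submits a set of pairs chosen as a function of the answers received in rounds $1,\dots,i-1$ (but not of answers in round $i$), and all of them are answered together. Let $G'$ be the graph on $V$ whose edges are the queried pairs answered positively. For $l\in\mathbb N$, $0<\delta_i<2$ ($1\le i\le l$) and $\alpha\le 2$, a $((\delta_1,\dots,\delta_l),l,\alpha)$-algorithm is an $l$-round algorithm making at most $n^{\delta_i}$ queries in round $i$ such that for every sufficiently large $n$, with probability at least $\frac12$ (over $G$), $G'$ contains a clique of size at least $\alpha\log n-o(\log n)$. $\alpha_*((\delta_1,\dots,\delta_l),l)$ is the supremum of $\alpha$ for which such an algorithm exists. *)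

theory Defs
  imports "HOL-Probability.Probability" "HOL-Probability.Product_PMF" "HOL-Library.Landau_Symbols"
begin

text \<open>The vertex set is \<open>{..<n}\<close>; a graph is identified with its set of edges.\<close>

definition vertex_pairs :: "nat \<Rightarrow> nat set set" where
  "vertex_pairs n = {{u, v} | u v. u < n \<and> v < n \<and> u \<noteq> v}"

definition random_graph :: "nat \<Rightarrow> nat set set pmf" where
  "random_graph n =
     map_pmf (\<lambda>f. {e \<in> vertex_pairs n. f e})
       (Pi_pmf (vertex_pairs n) False (\<lambda>_. bernoulli_pmf (1/2)))"

definition clique :: "nat \<Rightarrow> nat set set \<Rightarrow> nat set \<Rightarrow> bool" where
  "clique n E C \<longleftrightarrow> C \<subseteq> {..<n} \<and> (\<forall>u\<in>C. \<forall>v\<in>C. u \<noteq> v \<longrightarrow> {u, v} \<in> E)"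

text \<open>The answers to one round of queries form a partial map defined exactly on the queried
  pairs. A deterministic strategy maps the list of answers to all previous rounds
  (in chronological order) to the set of pairs queried next.\<close>

type_synonym answers = "nat set \<Rightarrow> bool option"
type_synonym strategy = "answers list \<Rightarrow> nat set set"

definition answer :: "nat set set \<Rightarrow> nat set set \<Rightarrow> answers" where
  "answer G Q = (\<lambda>e. if e \<in> Q then Some (e \<in> G) else None)"

primrec history :: "strategy \<Rightarrow> nat set set \<Rightarrow> nat \<Rightarrow> answers list" where
  "history S G 0 = []"
| "history S G (Suc i) = history S G i @ [answer G (S (history S G i))]"

text \<open>Rounds are numbered from \<open>0\<close>, in accordance with list indexing.\<close>

definition queries :: "strategy \<Rightarrow> nat set set \<Rightarrow> nat \<Rightarrow> nat set set" where
  "queries S G i = S (history S G i)"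

definition discovered_graph :: "strategy \<Rightarrow> nat \<Rightarrow> nat set set \<Rightarrow> nat set set" where
  "discovered_graph S l G = (\<Union>i<l. {e \<in> queries S G i. e \<in> G})"

text \<open>An algorithm is a family of strategies, one for each number \<open>n\<close> of vertices.
  The query bounds hold in the worst case, that is, for every graph. The function \<open>g\<close> is
  the error term \<open>o(log n)\<close>, which may depend on the algorithm.\<close>

definition clique_algorithm :: "real list \<Rightarrow> nat \<Rightarrow> real \<Rightarrow> (nat \<Rightarrow> strategy) \<Rightarrow> bool" where
  "clique_algorithm \<delta>s l \<alpha> A \<longleftrightarrow>
     length \<delta>s = l \<and> (\<forall>i<l. 0 < \<delta>s ! i \<and> \<delta>s ! i < 2) \<and> \<alpha> \<le> 2 \<and>
     (\<forall>n. \<forall>G \<subseteq> vertex_pairs n. \<forall>i<l.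
        queries (A n) G i \<subseteq> vertex_pairs n \<and>
        real (card (queries (A n) G i)) \<le> real n powr (\<delta>s ! i)) \<and>
     (\<exists>g :: nat \<Rightarrow> real. g \<in> o(\<lambda>n. log 2 (real n)) \<and>
        (\<forall>\<^sub>F n in sequentially.
           measure_pmf.prob (random_graph n)
             {G. \<exists>C. clique n (discovered_graph (A n) l G) C \<and>
                     real (card C) \<ge> \<alpha> * log 2 (real n) - g n} \<ge> 1/2))"

text \<open>For admissible \<open>\<delta>s\<close> the set below contains \<open>0\<close> and is bounded above by \<open>2\<close>,
  so the real supremum is the actual one.\<close>

definition alpha_star :: "real list \<Rightarrow> nat \<Rightarrow> real" where
  "alpha_star \<delta>s l = Sup {\<alpha>. \<exists>A. clique_algorithm \<delta>s l \<alpha> A}"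

end

theory Submission
  imports Defs "HOL-Real_Asymp.Real_Asymp"
begin

text \<open>Write \<open>L = log n\<close>, \<open>t = \<delta>/2\<close> and colour each pair of a discovered clique \<open>C\<close> by the round
  in which it was first queried. For a chain of subsets \<open>S\<^sub>0 \<subseteq> S\<^sub>1 \<subseteq> S\<^sub>2\<close> of \<open>C\<close> such that \<open>S\<^sub>i\<close> can be
  specified as soon as the queries of round \<open>i\<close> are known, a first moment argument bounds the
  number of pairs of colour \<open>i\<close> inside \<open>S\<^sub>i\<close>, summed over \<open>i\<close>, by the binary logarithm of
  the number of possible chains. A vertex matched by a queried edge of round \<open>i\<close> costs \<open>\<delta>\<^sub>i L / 2\<close>, a
  vertex touched by the first round costs \<open>(1 - t) L\<close>, and any other vertex costs \<open>L\<close>.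

  Split \<open>C\<close> into a maximum matching of colour \<open>0\<close> (\<open>p L\<close> vertices), a maximum matching of
  colour \<open>1\<close> in the rest (\<open>q L\<close> vertices) and a remainder (\<open>j L\<close> vertices), all of whose pairs
  have colour \<open>2\<close>. As a maximum matching has no augmenting path, at most half of the pairs between it and
  the rest have its colour. Three choices of the chain then give, up to \<open>o(1)\<close>,
  \<open>p \<le> 1 - t\<close>, \<open>(p + q + j)\<^sup>2 \<le> (1 - t) p + q + p q / 2 + 2 j\<close> and
  \<open>(p + q + j)\<^sup>2 \<le> (1 - t) p + q + p q / 2 + 2 t j + 2 p j + q j\<close>, and these three inequalities
  force \<open>p + q + j \<le> 1 + t\<close>.\<close>

section \<open>The first moment bound for adaptive queries\<close>

definition pairs :: "nat set \<Rightarrow> nat set set" where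
  "pairs X = {e. e \<subseteq> X \<and> card e = 2}"

lemma vertex_pairs_eq_pairs: "vertex_pairs n = pairs {..<n}"
  unfolding vertex_pairs_def pairs_def card_2_iff by auto

lemma finite_pairs: "finite X \<Longrightarrow> finite (pairs X)"
  unfolding pairs_def by simp

lemma card_pairs: "finite X \<Longrightarrow> card (pairs X) = card X choose 2"
  unfolding pairs_def by (rule n_subsets)

lemma card_pairs_real: "finite X \<Longrightarrow> real (card (pairs X)) = real (card X) * (real (card X) - 1) / 2"
  by (cases "card X") (simp_all add: card_pairs choose_two real_of_nat_div algebra_simps)

lemma pairs_mono: "X \<subseteq> Y \<Longrightarrow> pairs X \<subseteq> pairs Y"
  unfolding pairs_def by auto

lemma doubleton_in_pairs_iff: "{x, y} \<in> pairs X \<longleftrightarrow> x \<in> X \<and> y \<in> X \<and> x \<noteq> y"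
  unfolding pairs_def by (auto simp: card_2_iff doubleton_eq_iff)

lemma pairsE:
  assumes "e \<in> pairs X"
  obtains x y where "e = {x, y}" "x \<in> X" "y \<in> X" "x \<noteq> y"
  using assms unfolding pairs_def card_2_iff by auto

text \<open>A strategy may repeat queries. Discarding the repetitions gives each queried pair a
  unique round, its colour, so that the pair is selected or rejected only once.\<close>

definition fresh_queries :: "strategy \<Rightarrow> nat set set \<Rightarrow> nat \<Rightarrow> nat set set" where
  "fresh_queries S G i = queries S G i - (\<Union>j<i. queries S G j)"

text \<open>The rule \<open>T\<close> sees the history before round \<open>i\<close>, hence it also
  knows the queries of round \<open>i\<close>, but none of the answers to them.\<close>

definition selected ::
    "strategy \<Rightarrow> nat \<Rightarrow> (answers list \<Rightarrow> nat set set) \<Rightarrow> nat set set \<Rightarrow> nat set set" where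
  "selected S l T G = (\<Union>i<l. T (history S G i) \<inter> fresh_queries S G i)"

section \<open>Replaying a run from a reduced graph\<close>

lemma length_history: "length (history S G i) = i"
  by (induction i) auto

lemma take_history: "j \<le> i \<Longrightarrow> take j (history S G i) = history S G j"
proof (induction i)
  case (Suc i)
  show ?case
  proof (cases "j = Suc i")
    case True
    then show ?thesis by (metis length_history order_refl take_all)
  next
    case False
    then show ?thesis using Suc by (simp add: length_history)
  qed
qed simp

text \<open>Induction over the rounds. A pair queried in round i was first queried in some round j
  \<le> i, before which both runs share their history, so \<open>T\<close> selects it in both runs
  or in neither. If selected, it is an edge of both graphs; otherwise it lies in neither X nor X',
  and G - X = G' - X' settles its answer.\<close>

lemma history_eqI:
  assumes sel: "selected S l T G \<subseteq> G" "selected S l T G' \<subseteq> G'"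
    and X: "X \<subseteq> selected S l T G" "X' \<subseteq> selected S l T G'" and eq: "G - X = G' - X'"
  shows "i \<le> l \<Longrightarrow> \<forall>j\<le>i. history S G j = history S G' j"
proof (induction i)
  case (Suc i)
  then have IH: "\<forall>j\<le>i. history S G j = history S G' j" by simp
  then have q: "\<forall>j\<le>i. queries S G j = queries S G' j" by (simp add: queries_def)
  then have fr: "\<forall>j\<le>i. fresh_queries S G j = fresh_queries S G' j"
    by (auto simp: fresh_queries_def)
  have fresh_unique: "a = b" if "e \<in> fresh_queries S H a" "e \<in> fresh_queries S H b" for e a b H
    using that by (cases a b rule: linorder_cases) (auto simp: fresh_queries_def)
  have "e \<in> G \<longleftrightarrow> e \<in> G'" if e: "e \<in> queries S G i" for e
  proof -
    define j where "j = (LEAST j. e \<in> queries S G j)"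
    have j: "j \<le> i" "e \<in> queries S G j"
      using e unfolding j_def by (auto intro: Least_le LeastI)
    have jf: "e \<in> fresh_queries S G j"
      using j(2) not_less_Least unfolding fresh_queries_def j_def by auto
    have jf': "e \<in> fresh_queries S G' j" using jf fr j(1) by auto
    have hj: "history S G j = history S G' j" using IH j(1) by blast
    have jl: "j < l" using j(1) Suc.prems by simp
    show ?thesis
    proof (cases "e \<in> T (history S G j)")
      case True
      then have "e \<in> selected S l T G" "e \<in> selected S l T G'"
        unfolding selected_def using jf jf' jl hj by (metis IntI UN_I lessThan_iff)+
      then show ?thesis using sel by blast
    next
      case False
      then have "e \<notin> selected S l T G"
        unfolding selected_def using fresh_unique[OF _ jf] by blast
      moreover have "e \<notin> selected S l T G'"
        unfolding selected_def using False fresh_unique[OF _ jf'] hj by force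
      ultimately show ?thesis using X eq by blast
    qed
  qed
  then have "answer G (queries S G i) = answer G' (queries S G i)"
    by (auto simp: answer_def)
  moreover have "history S G i = history S G' i" using IH by blast
  ultimately have "history S G (Suc i) = history S G' (Suc i)"
    by (simp add: queries_def)
  with IH show ?case by (metis le_SucE)
qed simp

lemma selected_cong:
  assumes "\<And>i. i < l \<Longrightarrow> history S G i = history S G' i"
  shows "selected S l T G = selected S l T G'"
proof -
  have q: "queries S G i = queries S G' i" if "i < l" for i
    using assms[OF that] by (simp add: queries_def)
  have "fresh_queries S G i = fresh_queries S G' i" if "i < l" for i
  proof -
    have "(\<Union>j<i. queries S G j) = (\<Union>j<i. queries S G' j)"
      using q that by (intro SUP_cong) auto
    then show ?thesis unfolding fresh_queries_def using q[OF that] by simp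
  qed
  then show ?thesis unfolding selected_def using assms by (intro SUP_cong) auto
qed

text \<open>\<open>(G, X) \<mapsto> G - X\<close> is injective on pairs with \<open>X \<subseteq> selected S l T G \<subseteq> G\<close>: the positive answers on the
  selected pairs are known in advance, so the run of the strategy can be replayed from \<open>G - X\<close>.\<close>

lemma card_selected_subset_le:
  assumes V: "finite V"
  shows "card {G. G \<subseteq> V \<and> selected S l T G \<subseteq> G \<and> m \<le> card (selected S l T G)} * 2 ^ m
    \<le> 2 ^ card V"
proof -
  define A where "A = {G. G \<subseteq> V \<and> selected S l T G \<subseteq> G \<and> m \<le> card (selected S l T G)}"
  let ?R = "selected S l T"
  let ?P = "SIGMA G:A. Pow (?R G)"
  have finA: "finite A" unfolding A_def 
    by (rule finite_subset[of _ "Pow V"]) (use V in auto)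
  have finR: "finite (?R G)" if "G \<in> A" for G
  proof -
    have "?R G \<subseteq> V" using that unfolding A_def by blast
    then show ?thesis using V by (rule finite_subset)
  qed
  have "inj_on (\<lambda>(G, X). G - X) ?P"
  proof (rule inj_onI, clarsimp simp: A_def)
    fix G X G' X'
    assume a: "X \<subseteq> ?R G" "X' \<subseteq> ?R G'" "?R G \<subseteq> G" "?R G' \<subseteq> G'" "G - X = G' - X'"
    have h: "\<forall>j\<le>l. history S G j = history S G' j"
      using history_eqI[OF a(3,4,1,2,5)] by blast
    then have "?R G = ?R G'"
      by (intro selected_cong) simp
    then show "G = G' \<and> X = X'" using a by blast
  qed
  moreover have "(\<lambda>(G, X). G - X) ` ?P \<subseteq> Pow V" unfolding A_def by auto
  ultimately have "card ?P \<le> card (Pow V)" using V by (intro card_inj_on_le) simp_all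
  \<comment> \<open>Every graph in \<open>A\<close> is paired with all subsets of its selected set,
    of which there are at least 2 ^ m.\<close>
  moreover have "card A * 2 ^ m \<le> card ?P"
  proof -
    have "card A * 2 ^ m = (\<Sum>G\<in>A. 2 ^ m)" by simp
    also have "\<dots> \<le> (\<Sum>G\<in>A. 2 ^ card (?R G))" 
      by (intro sum_mono power_increasing) (auto simp: A_def)
    also have "\<dots> = (\<Sum>G\<in>A. card (Pow (?R G)))"
      by (intro sum.cong refl) (simp add: card_Pow finR)
    also have "\<dots> = card ?P" 
      by (intro card_SigmaI[symmetric] ballI) (simp_all add: finA finR)
    finally show ?thesis .
  qed
  ultimately show ?thesis using V by (simp add: card_Pow flip: A_def)
qed

section \<open>Union bound over chains of vertex sets\<close>

definition scheme_event ::
    "strategy \<Rightarrow> nat \<Rightarrow> (answers list \<Rightarrow> nat set set) \<Rightarrow> nat \<Rightarrow> nat set set set" where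
  "scheme_event S l F m = {G. \<exists>D. (\<forall>i<l. D i \<in> F (history S G i)) \<and>
     (\<Union>i<l. pairs (\<Union>j\<le>i. D j) \<inter> fresh_queries S G i) \<subseteq> G \<and>
     m \<le> card (\<Union>i<l. pairs (\<Union>j\<le>i. D j) \<inter> fresh_queries S G i)}"

text \<open>The set \<open>D i\<close> is what round \<open>i\<close> adds to the chain. The menus
  \<open>F (history S G i)\<close> vary with the graph, so the union bound runs over positions in
  the menus. A fixed vector of positions turns into a selection rule that depends on histories only,
  and \<open>card_selected_subset_le\<close> applies to it.\<close>

lemma card_scheme_event_le:
  assumes V: "finite V"
    and F: "\<And>G i. G \<subseteq> V \<Longrightarrow> i < l \<Longrightarrow>
      finite (F (history S G i)) \<and> card (F (history S G i)) \<le> N i"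
  shows "card (Pow V \<inter> scheme_event S l F m) * 2 ^ m \<le> (\<Prod>i<l. N i) * 2 ^ card V"
proof -
  \<comment> \<open>The length of \<open>h\<close> is the current round and \<open>take j h\<close>
    is the history before round \<open>j\<close>, so the rule can look up every menu up to the
    present one.\<close>
  define T where "T \<iota> h = pairs (\<Union>j\<le>length h. from_nat_into (F (take j h)) (\<iota> j))"
    for \<iota> :: "nat \<Rightarrow> nat" and h :: "answers list"
  define I where "I = PiE {..<l} (\<lambda>i. {..<N i})"
  define A where "A \<iota> = {G. G \<subseteq> V \<and> selected S l (T \<iota>) G \<subseteq> G \<and> m \<le> card (selected S l (T \<iota>) G)}" for \<iota>
  have finI: "finite I" unfolding I_def by (auto intro: finite_PiE)
  have cI: "card I = (\<Prod>i<l. N i)" unfolding I_def by (simp add: card_PiE)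
  have finA: "finite (A \<iota>)" for \<iota> unfolding A_def 
    by (rule finite_subset[of _ "Pow V"]) (use V in auto)
  have "Pow V \<inter> scheme_event S l F m \<subseteq> (\<Union>\<iota>\<in>I. A \<iota>)"
  proof
    fix G assume G: "G \<in> Pow V \<inter> scheme_event S l F m"
    then obtain D where D: "\<forall>i<l. D i \<in> F (history S G i)"
       "(\<Union>i<l. pairs (\<Union>j\<le>i. D j) \<inter> fresh_queries S G i) \<subseteq> G"
       "m \<le> card (\<Union>i<l. pairs (\<Union>j\<le>i. D j) \<inter> fresh_queries S G i)"
      unfolding scheme_event_def by blast
    define \<iota> where "\<iota> = (\<lambda>i\<in>{..<l}. to_nat_on (F (history S G i)) (D i))"
    have "\<iota> i < N i" if "i < l" for i
    proof -
      have *: "finite (F (history S G i))" "card (F (history S G i)) \<le> N i" using F that G by auto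
      have "to_nat_on (F (history S G i)) (D i) \<in> {..<card (F (history S G i))}"
        using bij_betwE[OF to_nat_on_finite[OF *(1)]] D(1) that by blast
      then show ?thesis using * that by (auto simp: \<iota>_def)
    qed
    then have "\<iota> \<in> I" unfolding I_def by (auto simp: \<iota>_def)
    moreover have "from_nat_into (F (history S G i)) (\<iota> i) = D i" if "i < l" for i
      using that D(1) F G by (auto simp: \<iota>_def intro!: from_nat_into_to_nat_on countable_finite)
    then have "T \<iota> (history S G i) = pairs (\<Union>j\<le>i. D j)" if "i < l" for i
      using that unfolding T_def by (auto simp: length_history take_history)
    then have "selected S l (T \<iota>) G = (\<Union>i<l. pairs (\<Union>j\<le>i. D j) \<inter> fresh_queries S G i)"
      by (auto simp: selected_def)
    then have "G \<in> A \<iota>" using D G by (auto simp: A_def)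
    ultimately show "G \<in> (\<Union>\<iota>\<in>I. A \<iota>)" by blast
  qed
  then have "card (Pow V \<inter> scheme_event S l F m) \<le> card (\<Union>\<iota>\<in>I. A \<iota>)"
    using finI finA by (intro card_mono) auto
  also have "\<dots> \<le> (\<Sum>\<iota>\<in>I. card (A \<iota>))" using finI by (rule card_UN_le)
  finally have "card (Pow V \<inter> scheme_event S l F m) * 2 ^ m \<le> (\<Sum>\<iota>\<in>I. card (A \<iota>) * 2 ^ m)"
    by (simp flip: sum_distrib_right)
  also have "\<dots> \<le> (\<Sum>\<iota>\<in>I. 2 ^ card V)"
    unfolding A_def by (intro sum_mono card_selected_subset_le V)
  finally show ?thesis by (simp add: cI)
qed

section \<open>Chains built from queried edges and single vertices\<close>

definition stage :: "nat set set \<Rightarrow> nat set \<Rightarrow> nat \<Rightarrow> nat \<Rightarrow> nat set set" where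
  "stage Q W a b = {\<Union>E \<union> X | E X. E \<subseteq> Q \<and> card E = a \<and> X \<subseteq> W \<and> card X = b}"

lemma binomial_le_power: "n choose r \<le> n ^ r"
  by (cases "r \<le> n") (auto intro: binomial_le_pow simp: binomial_eq_0)

lemma finite_card_stage:
  assumes "finite Q" "finite W"
  shows "finite (stage Q W a b) \<and> card (stage Q W a b) \<le> card Q ^ a * card W ^ b"
proof -
  let ?P = "{E. E \<subseteq> Q \<and> card E = a} \<times> {X. X \<subseteq> W \<and> card X = b}"
  have eq: "stage Q W a b = (\<lambda>(E, X). \<Union>E \<union> X) ` ?P"
    unfolding stage_def by auto
  have fin: "finite ?P" using assms by simp
  have "card ?P = (card Q choose a) * (card W choose b)"
    using assms by (simp add: card_cartesian_product n_subsets)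
  also have "\<dots> \<le> card Q ^ a * card W ^ b" by (intro mult_mono binomial_le_power) auto
  finally show ?thesis unfolding eq using fin card_image_le[OF fin] le_trans by blast
qed

text \<open>Vertices are named in two ways because the prices differ: a queried edge names two
  vertices for the logarithm of the number of queries, while a single vertex is drawn from a pool.
  In round 0, recognised by the empty history, the pool holds only the vertices touched by the
  queries; later it holds all vertices.\<close>

definition stages ::
    "strategy \<Rightarrow> nat \<Rightarrow> nat list \<Rightarrow> nat list \<Rightarrow> answers list \<Rightarrow> nat set set" where
  "stages S n as bs h =
     stage (S h) (if h = [] then \<Union>(S h) else {..<n}) (as ! length h) (bs ! length h)"

lemma prob_random_graph:
  "measure_pmf.prob (random_graph n) A = real (card (Pow (vertex_pairs n) \<inter> A)) / 2 ^ card (vertex_pairs n)"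
proof -
  have fin: "finite (vertex_pairs n)" by (simp add: vertex_pairs_eq_pairs finite_pairs)
  have "random_graph n = pmf_of_set (Pow (vertex_pairs n))"
    unfolding random_graph_def by (rule pmf_of_set_Pow_conv_bernoulli[OF fin])
  then show ?thesis using fin by (simp add: measure_pmf_of_set card_Pow Pow_not_empty)
qed

text \<open>The exponent is a bound on the logarithm of the number of chains, minus
  \<open>m\<close>. The single vertices of round 0 come from a pool of at most 2 n^d0 vertices, and
  this factor 2 is the source of the separate summand \<open>b0\<close>.\<close>

lemma prob_stages_le:
  assumes n: "n \<ge> 1"
    and q: "\<And>G i. G \<subseteq> vertex_pairs n \<Longrightarrow> i < 3 \<Longrightarrow> queries S G i \<subseteq> vertex_pairs n \<and>
      real (card (queries S G i)) \<le> real n powr ([d0, d1, d2] ! i)"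
  shows "measure_pmf.prob (random_graph n)
      (scheme_event S 3 (stages S n [a0, a1, a2] [b0, b1, b2]) m)
    \<le> 2 powr (log 2 n * (d0 * (a0 + b0) + d1 * a1 + b1 + d2 * a2 + b2) + b0 - m)"
proof -
  define V where "V = vertex_pairs n"
  define L where "L = log 2 (real n)"
  have finV: "finite V" by (simp add: V_def vertex_pairs_eq_pairs finite_pairs)
  \<comment> \<open>Query counts are integers, so rounding down keeps the bound and makes it usable
    in the product of natural numbers \<open>N\<close>.\<close>
  define K where "K d = nat \<lfloor>real n powr d\<rfloor>" for d
  have n2: "real n = 2 powr L" using n by (simp add: L_def)
  have K: "real (K d) \<le> 2 powr (L * d)" for d
    unfolding K_def n2 powr_powr by simp
  define N where "N = (\<lambda>i. [K d0 ^ a0 * (2 * K d0) ^ b0, K d1 ^ a1 * n ^ b1, K d2 ^ a2 * n ^ b2] ! i)"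
  have F: "finite (stages S n [a0, a1, a2] [b0, b1, b2] (history S G i)) \<and>
     card (stages S n [a0, a1, a2] [b0, b1, b2] (history S G i)) \<le> N i"
    if G: "G \<subseteq> V" and i: "i < 3" for G i
  proof -
    let ?Q = "S (history S G i)"
    let ?W = "if history S G i = [] then \<Union>?Q else {..<n}"
    have Q: "?Q \<subseteq> V" "real (card ?Q) \<le> real n powr ([d0, d1, d2] ! i)"
      using q[of G i] G i by (auto simp: V_def queries_def)
    have finQ: "finite ?Q" using Q(1) finV by (rule finite_subset)
    have cQ: "card ?Q \<le> K ([d0, d1, d2] ! i)" unfolding K_def using Q(2) by (rule le_nat_floor)
    have e2: "finite e" "card e = 2" if "e \<in> ?Q" for e
    proof -
      show "card e = 2" using that Q(1) by (auto simp: V_def vertex_pairs_eq_pairs pairs_def)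
      then show "finite e" using card.infinite by fastforce
    qed
    have UQ: "card (\<Union>?Q) \<le> 2 * card ?Q"
    proof -
      have "card (\<Union>?Q) \<le> (\<Sum>e\<in>?Q. card e)" using card_UN_le[OF finQ, of "\<lambda>e. e"] by simp
      also have "\<dots> = (\<Sum>e\<in>?Q. 2)" using e2 by (intro sum.cong) auto
      finally show ?thesis by simp
    qed
    have empty: "history S G i = [] \<longleftrightarrow> i = 0" by (metis length_history length_0_conv)
    have finW: "finite ?W" using finQ e2 by auto
    have cW: "card ?W \<le> [2 * K d0, n, n] ! i"
    proof (cases "i = 0")
      case True
      then have "card ?W \<le> 2 * card ?Q" using UQ empty by simp
      also have "\<dots> \<le> 2 * K d0" using cQ True by simp
      finally show ?thesis using True by simp
    next
      case False
      then have "i = 1 \<or> i = 2" using i by auto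
      then show ?thesis using False empty by auto
    qed
    have "card (stages S n [a0, a1, a2] [b0, b1, b2] (history S G i))
        \<le> card ?Q ^ ([a0, a1, a2] ! i) * card ?W ^ ([b0, b1, b2] ! i)"
      unfolding stages_def using finite_card_stage[OF finQ finW] by (simp only: length_history)
    also have "\<dots> \<le> K ([d0, d1, d2] ! i) ^ ([a0, a1, a2] ! i) * ([2 * K d0, n, n] ! i) ^ ([b0, b1, b2] ! i)"
      by (intro mult_mono power_mono cQ cW) auto
    also have "\<dots> = N i"
    proof -
      have "i = 0 \<or> i = 1 \<or> i = 2" using i by auto
      then show ?thesis unfolding N_def by auto
    qed
    finally show ?thesis
      unfolding stages_def using finite_card_stage[OF finQ finW] by blast
  qed
  have pw: "(2 powr x) ^ a = 2 powr (x * real a)" for x a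
    by (simp add: powr_power mult.commute)
  let ?A = "scheme_event S 3 (stages S n [a0, a1, a2] [b0, b1, b2]) m"
  have "(\<Prod>i<3. N i) = N 0 * N 1 * N 2" by (simp add: numeral_eq_Suc)
  also have "real \<dots> = real (K d0) ^ a0 * (2 * real (K d0)) ^ b0 * (real (K d1) ^ a1 * real n ^ b1)
      * (real (K d2) ^ a2 * real n ^ b2)"
    unfolding N_def by simp
  also have "\<dots> \<le> (2 powr (L * d0)) ^ a0 * (2 * 2 powr (L * d0)) ^ b0 *
      ((2 powr (L * d1)) ^ a1 * (2 powr L) ^ b1) * ((2 powr (L * d2)) ^ a2 * (2 powr L) ^ b2)"
    unfolding n2[symmetric] by (intro mult_mono power_mono K mult_nonneg_nonneg) (auto simp: n2 K)
  also have "2 * 2 powr (L * d0) = 2 powr (1 + L * d0)" by (simp add: powr_add)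
  also have "(2 powr (L * d0)) ^ a0 * (2 powr (1 + L * d0)) ^ b0 *
      ((2 powr (L * d1)) ^ a1 * (2 powr L) ^ b1) * ((2 powr (L * d2)) ^ a2 * (2 powr L) ^ b2)
     = 2 powr (L * (d0 * (a0 + b0) + d1 * a1 + b1 + d2 * a2 + b2) + b0)"
    unfolding pw powr_add[symmetric] by (simp add: algebra_simps)
  finally have prodN: "real (\<Prod>i<3. N i) \<le> 2 powr (L * (d0 * (a0 + b0) + d1 * a1 + b1 + d2 * a2 + b2) + b0)" .
  have "card (Pow V \<inter> ?A) * 2 ^ m \<le> (\<Prod>i<3. N i) * 2 ^ card V"
    by (intro card_scheme_event_le finV F)
  then have "real (card (Pow V \<inter> ?A)) * 2 ^ m \<le> real (\<Prod>i<3. N i) * 2 ^ card V"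
    by (metis (mono_tags, lifting) of_nat_le_iff of_nat_mult of_nat_numeral of_nat_power)
  moreover have "x / c \<le> y / d" if "x * d \<le> y * c" "0 < c" "0 < d" for x y c d :: real
    using that by (simp add: field_simps)
  ultimately have "real (card (Pow V \<inter> ?A)) / 2 ^ card V \<le> real (\<Prod>i<3. N i) / 2 ^ m"
    by (meson zero_less_numeral zero_less_power)
  also have "\<dots> \<le> 2 powr (L * (d0 * (a0 + b0) + d1 * a1 + b1 + d2 * a2 + b2) + b0) / 2 ^ m"
    by (intro divide_right_mono prodN) auto
  also have "\<dots> = 2 powr (L * (d0 * (a0 + b0) + d1 * a1 + b1 + d2 * a2 + b2) + b0 - m)"
    by (simp add: powr_diff powr_realpow)
  finally show ?thesis unfolding prob_random_graph V_def L_def .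
qed

section \<open>Maximum matchings in a clique\<close>

lemma stageI: "E \<subseteq> Q \<Longrightarrow> X \<subseteq> W \<Longrightarrow> \<Union>E \<union> X \<in> stage Q W (card E) (card X)"
  unfolding stage_def by blast

lemma empty_in_stage: "{} \<in> stage Q W 0 0"
  using stageI[of "{}" Q "{}" W] by simp

text \<open>The path z, a, b, z' is augmenting: {a, b} is exchanged for the two outer edges.\<close>

lemma augmenting_path:
  assumes M: "M \<subseteq> E" "disjoint M" "finite M" and ab: "{a, b} \<in> M" "a \<noteq> b"
    and z: "z \<notin> \<Union>M" "z' \<notin> \<Union>M" "z \<noteq> z'" and E: "{a, z} \<in> E" "{b, z'} \<in> E"
  shows "\<exists>M'\<subseteq>E. disjoint M' \<and> card M' = Suc (card M)"
proof -
  define M0 where "M0 = M - {{a, b}}"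
  have M0: "disjoint M0" "M0 \<subseteq> E" "finite M0"
    using M unfolding M0_def pairwise_def by auto
  have "f \<inter> {a, b} = {}" if "f \<in> M0" for f
    using pairwiseD[OF M(2) _ ab(1), of f] that unfolding M0_def disjnt_def by blast
  then have ab0: "a \<notin> \<Union>M0" "b \<notin> \<Union>M0" by auto
  have z0: "z \<notin> \<Union>M0" "z' \<notin> \<Union>M0" using z unfolding M0_def by auto
  have za: "z \<noteq> a" "z \<noteq> b" "z' \<noteq> a" "z' \<noteq> b" using z ab by auto
  have d1: "disjoint (insert {b, z'} M0)"
    using M0(1) ab0 z0 unfolding pairwise_insert disjnt_def by auto
  have d2: "disjoint (insert {a, z} (insert {b, z'} M0))"
    using d1 ab0 z0 za z(3) ab(2) unfolding pairwise_insert[of _ "{a, z}"] disjnt_def by auto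
  have "{b, z'} \<notin> M0" using ab0 by auto
  moreover have "{a, z} \<notin> insert {b, z'} M0" using ab0 za ab(2) by auto
  moreover have "card M0 = card M - 1" "card M > 0"
    using M(3) ab(1) unfolding M0_def by (auto simp: card_gt_0_iff)
  ultimately have "card (insert {a, z} (insert {b, z'} M0)) = Suc (card M)"
    using M0(3) by simp
  then show ?thesis using d2 E M0(2) by (intro exI[of _ "insert {a, z} (insert {b, z'} M0)"]) auto
qed

text \<open>A matching of greatest cardinality is taken. For its edge {a, b}, a neighbour of a and a
  neighbour of b in Y, both unmatched, must coincide by \<open>augmenting_path\<close>. So either
  one end has no neighbour in Y, or both have the same single one. Hence at most card Y + 2 pairs
  join {a, b} to Y, about half of the 2 card Y conceivable ones.\<close>

lemma exists_max_matching:
  assumes X: "finite X" and E: "E \<subseteq> pairs X"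
  obtains M where "M \<subseteq> E" "disjoint M" "finite M" "card (\<Union>M) = 2 * card M"
    "\<And>e. e \<in> E \<Longrightarrow> e \<inter> \<Union>M \<noteq> {}"
    "\<And>Y. finite Y \<Longrightarrow> Y \<inter> \<Union>M = {} \<Longrightarrow>
       card {e \<in> E. e \<inter> \<Union>M \<noteq> {} \<and> e \<inter> Y \<noteq> {}} \<le> card M * (card Y + 2)"
proof -
  have finE: "finite E" using E finite_pairs[OF X] by (rule finite_subset)
  have "\<exists>M. (M \<subseteq> E \<and> disjoint M) \<and> (\<forall>M'. M' \<subseteq> E \<and> disjoint M' \<longrightarrow> card M' \<le> card M)"
    by (rule ex_has_greatest_nat[where k="{}" and b="Suc (card E)"])
      (auto intro: card_mono[OF finE] le_imp_less_Suc)
  then obtain M where M: "M \<subseteq> E" "disjoint M"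
    and max: "\<And>M'. M' \<subseteq> E \<Longrightarrow> disjoint M' \<Longrightarrow> card M' \<le> card M" by blast
  have finM: "finite M" using M(1) finE by (rule finite_subset)
  have card2: "card e = 2" if "e \<in> E" for e using that E unfolding pairs_def by auto
  have fin2: "finite e" if "e \<in> E" for e using card2[OF that] card.infinite by fastforce
  have cardM: "card (\<Union>M) = 2 * card M"
  proof -
    have "card (\<Union>M) = (\<Sum>e\<in>M. card e)"
      using M fin2 by (intro card_Union_disjoint) auto
    also have "\<dots> = (\<Sum>e\<in>M. 2)" using M card2 by (intro sum.cong) auto
    finally show ?thesis by simp
  qed
  have maximal: "e \<inter> \<Union>M \<noteq> {}" if e: "e \<in> E" for e
  proof
    assume *: "e \<inter> \<Union>M = {}"
    have "e \<noteq> {}" using card2[OF e] by auto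
    then have "e \<notin> M" using * by auto
    moreover have "disjoint (insert e M)"
      using M(2) * unfolding pairwise_insert disjnt_def by auto
    then have "card (insert e M) \<le> card M" using M(1) e by (intro max) auto
    ultimately show False using finM by simp
  qed
  have "card {e \<in> E. e \<inter> \<Union>M \<noteq> {} \<and> e \<inter> Y \<noteq> {}} \<le> card M * (card Y + 2)"
    if Y: "finite Y" "Y \<inter> \<Union>M = {}" for Y
  proof -
    have single: "card {f \<in> E. f \<inter> e \<noteq> {} \<and> f \<inter> Y \<noteq> {}} \<le> card Y + 2" if e: "e \<in> M" for e
    proof -
      obtain a b where ab: "e = {a, b}" "a \<noteq> b"
        using card2 e M(1) by (metis card_2_iff subsetD)
      define Na where "Na = {z \<in> Y. {a, z} \<in> E}"
      define Nb where "Nb = {z \<in> Y. {b, z} \<in> E}"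
      have finN: "finite Na" "finite Nb" using Y unfolding Na_def Nb_def by auto
      have le: "card Na \<le> card Y" "card Nb \<le> card Y"
        using Y unfolding Na_def Nb_def by (auto intro: card_mono)
      have "{f \<in> E. f \<inter> e \<noteq> {} \<and> f \<inter> Y \<noteq> {}} \<subseteq> (\<lambda>z. {a, z}) ` Na \<union> (\<lambda>z. {b, z}) ` Nb"
      proof
        fix f assume "f \<in> {f \<in> E. f \<inter> e \<noteq> {} \<and> f \<inter> Y \<noteq> {}}"
        then obtain u z where f: "f \<in> E" "u \<in> f" "u \<in> e" "z \<in> f" "z \<in> Y" by blast
        then have "u \<noteq> z" using Y(2) e by auto
        then have "f = {u, z}" using card2[OF f(1)] f by (auto simp: card_2_iff)
        then show "f \<in> (\<lambda>z. {a, z}) ` Na \<union> (\<lambda>z. {b, z}) ` Nb"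
          using f ab by (auto simp: Na_def Nb_def)
      qed
      then have "card {f \<in> E. f \<inter> e \<noteq> {} \<and> f \<inter> Y \<noteq> {}}
          \<le> card ((\<lambda>z. {a, z}) ` Na \<union> (\<lambda>z. {b, z}) ` Nb)"
        using finN by (intro card_mono) auto
      also have "\<dots> \<le> card Na + card Nb"
        by (rule order_trans[OF card_Un_le add_mono]) (use finN in \<open>auto intro: card_image_le\<close>)
      also have "\<dots> \<le> card Y + 2"
      proof (cases "Na = {} \<or> Nb = {}")
        case True
        then show ?thesis using le by auto
      next
        case False
        have "z = z'" if "z \<in> Na" "z' \<in> Nb" for z z'
        proof (rule ccontr)
          assume zz: "z \<noteq> z'"
          have z: "z \<notin> \<Union>M" "z' \<notin> \<Union>M" and edges: "{a, z} \<in> E" "{b, z'} \<in> E"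
            using that Y(2) unfolding Na_def Nb_def by auto
          have "{a, b} \<in> M" using e ab(1) by simp
          from augmenting_path[OF M finM this ab(2) z zz edges]
          obtain M' where "M' \<subseteq> E" "disjoint M'" "card M' = Suc (card M)" by blast
          then show False using max[of M'] by simp
        qed
        moreover obtain z z' where "z \<in> Na" "z' \<in> Nb" using False by auto
        ultimately have "Na = {z}" "Nb = {z}" by auto
        then show ?thesis by simp
      qed
      finally show ?thesis .
    qed
    have "card {e \<in> E. e \<inter> \<Union>M \<noteq> {} \<and> e \<inter> Y \<noteq> {}}
        \<le> card (\<Union>e\<in>M. {f \<in> E. f \<inter> e \<noteq> {} \<and> f \<inter> Y \<noteq> {}})"
      using finM finE by (intro card_mono) auto
    also have "\<dots> \<le> (\<Sum>e\<in>M. card {f \<in> E. f \<inter> e \<noteq> {} \<and> f \<inter> Y \<noteq> {}})"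
      using finM by (rule card_UN_le)
    also have "\<dots> \<le> (\<Sum>e\<in>M. card Y + 2)" by (intro sum_mono single)
    finally show ?thesis by simp
  qed
  then show ?thesis using that M finM cardM maximal by blast
qed

text \<open>The numbers \<open>a0, a1, a2\<close> count the edges and \<open>b0, b1, b2\<close> the single vertices chosen in each stage.
  The two quadratic bounds come from the chains \<open>M\<^sub>1 \<union> Mt \<union> Jt \<subseteq> C \<subseteq> C\<close> and
  \<open>M\<^sub>1 \<union> Mt \<subseteq> M\<^sub>1 \<union> M\<^sub>2 \<subseteq> C\<close>, where \<open>Mt\<close> consists of the edges of \<open>M\<^sub>2\<close> with both
  ends touched by the first round and \<open>Jt\<close> of the vertices of \<open>J\<close> touched by it (matchings stand for their
  vertex sets). The sets \<open>lost\<close> contain the pairs that these chains do not count.\<close>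

lemma clique_decomposition:
  fixes C W :: "nat set" and Q\<^sub>1 Q\<^sub>2 Q\<^sub>3 :: "nat set set" and \<gamma> t L \<epsilon> :: real
  defines "H\<^sub>1 \<equiv> Q\<^sub>1" and "H\<^sub>2 \<equiv> Q\<^sub>2 - Q\<^sub>1" and "H\<^sub>3 \<equiv> Q\<^sub>3 - (Q\<^sub>1 \<union> Q\<^sub>2)"
  assumes C: "finite C" "C \<subseteq> W" "pairs C \<subseteq> Q\<^sub>1 \<union> Q\<^sub>2 \<union> Q\<^sub>3"
    and param: "0 \<le> L" "0 \<le> \<gamma>" "\<gamma> \<le> 1/2" "0 \<le> t"
    and few: "\<And>a0 a1 a2 b0 b1 b2 D0 D1 D2.
      {a0, a1, a2, b0, b1, b2} \<subseteq> {..card C} \<Longrightarrow> D0 \<union> D1 \<union> D2 \<subseteq> C \<Longrightarrow>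
      D0 \<in> stage Q\<^sub>1 (\<Union>Q\<^sub>1) a0 b0 \<Longrightarrow> D1 \<in> stage Q\<^sub>2 W a1 b1 \<Longrightarrow> D2 \<in> stage Q\<^sub>3 W a2 b2 \<Longrightarrow>
      real (card (pairs D0 \<inter> H\<^sub>1 \<union> pairs (D0 \<union> D1) \<inter> H\<^sub>2 \<union> pairs (D0 \<union> D1 \<union> D2) \<inter> H\<^sub>3))
        \<le> L * (\<gamma> * (a0 + b0) + a1 + b1 + 2 * t * a2 + b2) + b0 + \<epsilon>"
  obtains p q j :: nat where "p + q + j = card C"
    "real p * (real p - 1) \<le> L * (\<gamma> * p) + 2 * \<epsilon>"
    "(real (card C))\<^sup>2 \<le> L * (\<gamma> * p + q + 2 * j) + real p * q / 2 + 5 * card C + 2 * \<epsilon>"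
    "(real (card C))\<^sup>2 \<le> L * (\<gamma> * p + q + 2 * t * j) + real p * q / 2 + 2 * real p * j + real q * j
       + 5 * card C + 2 * L + 2 * \<epsilon>"
proof -
  define k where "k = card C"
  have finpC: "finite (pairs C)" using C(1) by (rule finite_pairs)
  have finp: "finite (pairs X)" if "X \<subseteq> C" for X
    using pairs_mono[OF that] finpC by (rule finite_subset)
  \<comment> \<open>The subscripts 1, 2, 3 stand for the colours 0, 1, 2. The sets \<open>P\<close>,
    \<open>U\<close> and \<open>J\<close> below are the vertices of the two matchings and the
    remainder.\<close>
  obtain M\<^sub>1 where M1: "M\<^sub>1 \<subseteq> pairs C \<inter> H\<^sub>1" "disjoint M\<^sub>1" "finite M\<^sub>1" "card (\<Union>M\<^sub>1) = 2 * card M\<^sub>1"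
    and max1: "\<And>e. e \<in> pairs C \<inter> H\<^sub>1 \<Longrightarrow> e \<inter> \<Union>M\<^sub>1 \<noteq> {}"
    and cross1: "\<And>Y. finite Y \<Longrightarrow> Y \<inter> \<Union>M\<^sub>1 = {} \<Longrightarrow>
       card {e \<in> pairs C \<inter> H\<^sub>1. e \<inter> \<Union>M\<^sub>1 \<noteq> {} \<and> e \<inter> Y \<noteq> {}} \<le> card M\<^sub>1 * (card Y + 2)"
    by (rule exists_max_matching[OF C(1), of "pairs C \<inter> H\<^sub>1"]) auto
  define P where "P = \<Union>M\<^sub>1"
  define R where "R = C - P"
  have PC: "P \<subseteq> C" using M1(1) unfolding P_def pairs_def by auto
  have finP: "finite P" "finite R" using PC C(1) by (auto simp: R_def intro: finite_subset[OF _ C(1)])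
  obtain M\<^sub>2 where M2: "M\<^sub>2 \<subseteq> pairs R \<inter> H\<^sub>2" "disjoint M\<^sub>2" "finite M\<^sub>2" "card (\<Union>M\<^sub>2) = 2 * card M\<^sub>2"
    and max2: "\<And>e. e \<in> pairs R \<inter> H\<^sub>2 \<Longrightarrow> e \<inter> \<Union>M\<^sub>2 \<noteq> {}"
    and cross2: "\<And>Y. finite Y \<Longrightarrow> Y \<inter> \<Union>M\<^sub>2 = {} \<Longrightarrow>
       card {e \<in> pairs R \<inter> H\<^sub>2. e \<inter> \<Union>M\<^sub>2 \<noteq> {} \<and> e \<inter> Y \<noteq> {}} \<le> card M\<^sub>2 * (card Y + 2)"
    by (rule exists_max_matching[OF finP(2), of "pairs R \<inter> H\<^sub>2"]) auto
  define U where "U = \<Union>M\<^sub>2"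
  define J where "J = R - U"
  have UR: "U \<subseteq> R" using M2(1) unfolding U_def pairs_def by auto
  have finU: "finite U" "finite J" using UR finP(2) by (auto simp: J_def intro: finite_subset[OF _ finP(2)])
  have C_eq: "C = P \<union> U \<union> J" and PU: "P \<inter> U = {}" and PJ: "P \<inter> J = {}" and UJ: "U \<inter> J = {}"
    using PC UR unfolding R_def J_def by auto
  have pairs_J: "e \<in> H\<^sub>3" if "e \<in> pairs J" for e
  proof -
    have eR: "e \<in> pairs R" "e \<in> pairs C" and eJ: "e \<subseteq> J"
      using that pairs_mono[of J R] pairs_mono[of J C] by (auto simp: J_def R_def pairs_def)
    have "e \<inter> P = {}" "e \<inter> U = {}" using eJ PJ UJ by auto
    then have "e \<notin> H\<^sub>1" "e \<notin> H\<^sub>2" using eR max1[of e] max2[of e] unfolding P_def U_def by auto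
    then show ?thesis using eR C(3) unfolding H\<^sub>1_def H\<^sub>2_def H\<^sub>3_def by auto
  qed
  \<comment> \<open>As all pairs of \<open>J\<close> have colour 2, a maximum matching misses at
    most one vertex. Naming \<open>J\<close> by queries of the last round thus costs t L per vertex
    instead of L.\<close>
  obtain M\<^sub>3 where M3: "M\<^sub>3 \<subseteq> pairs J" "disjoint M\<^sub>3" "finite M\<^sub>3" "card (\<Union>M\<^sub>3) = 2 * card M\<^sub>3"
    and max3: "\<And>e. e \<in> pairs J \<Longrightarrow> e \<inter> \<Union>M\<^sub>3 \<noteq> {}"
    by (rule exists_max_matching[OF finU(2), of "pairs J"]) auto
  define Z where "Z = J - \<Union>M\<^sub>3"
  have M3J: "\<Union>M\<^sub>3 \<subseteq> J" using M3(1) unfolding pairs_def by auto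
  have finZ: "finite Z" using finU by (simp add: Z_def)
  have "x = y" if "x \<in> Z" "y \<in> Z" for x y
    using max3[of "{x, y}"] that by (auto simp: Z_def doubleton_in_pairs_iff)
  then have cardZ: "card Z \<le> 1" using finZ by (auto simp: card_le_Suc0_iff_eq)
  define V1 where "V1 = \<Union>Q\<^sub>1"
  \<comment> \<open>Up to lower order, an edge of \<open>Mt\<close> can be named in round 0 by its
    two ends at cost 2 \<gamma> L, at most the L charged for it in round 1; naming it early makes
    the colour 0 pairs at its ends count. An edge of \<open>Mr\<close> has at most one touched end,
    and these ends form \<open>Y\<close>.\<close>
  define Mt where "Mt = {e \<in> M\<^sub>2. e \<subseteq> V1}"
  define Mr where "Mr = M\<^sub>2 - Mt"
  define Y where "Y = \<Union>Mr \<inter> V1"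
  have M_split: "M\<^sub>2 = Mt \<union> Mr" "Mt \<inter> Mr = {}" and finMt: "finite Mt" "finite Mr"
    using M2(3) unfolding Mr_def Mt_def by auto
  have U_split: "U = \<Union>Mt \<union> \<Union>Mr" unfolding U_def M_split(1) by auto
  have two: "card e = 2" "finite e" if "e \<in> M\<^sub>2" for e
  proof -
    show "card e = 2" using that M2(1) unfolding pairs_def by auto
    then show "finite e" using card.infinite by fastforce
  qed
  have cardMt: "card (\<Union>Mt) = 2 * card Mt"
  proof -
    have "card (\<Union>Mt) = (\<Sum>e\<in>Mt. card e)"
      using two M2(2) unfolding Mt_def by (intro card_Union_disjoint) (auto simp: pairwise_def)
    also have "\<dots> = (\<Sum>e\<in>Mt. 2)" using two unfolding Mt_def by (intro sum.cong) auto
    finally show ?thesis by simp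
  qed
  have cardY: "card Y \<le> card Mr"
  proof -
    have "card (e \<inter> V1) \<le> 1" if "e \<in> Mr" for e
    proof -
      have e: "e \<in> M\<^sub>2" "e \<inter> V1 \<noteq> e" using that unfolding Mr_def Mt_def by auto
      then have "card (e \<inter> V1) < card e" using two by (intro psubset_card_mono) auto
      then show ?thesis using two(1)[OF e(1)] by simp
    qed
    moreover have "Y = (\<Union>e\<in>Mr. e \<inter> V1)" unfolding Y_def by auto
    then have "card Y \<le> (\<Sum>e\<in>Mr. card (e \<inter> V1))" 
      using card_UN_le[OF finMt(2), of "\<lambda>e. e \<inter> V1"] by (simp only:)
    ultimately show ?thesis using sum_mono[of Mr "\<lambda>e. card (e \<inter> V1)" "\<lambda>_. 1"] by simp
  qed
  have YU: "Y \<subseteq> U" "finite Y" unfolding Y_def U_split[symmetric] using U_split by (auto intro: finite_subset[OF _ finU(1)])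
  define Jt where "Jt = J \<inter> V1"
  define Ju where "Ju = J - V1"
  have J_split: "J = Jt \<union> Ju" "card J = card Jt + card Ju" "finite Jt" "finite Ju"
    using finU card_Int_Diff[OF finU(2), of V1]
    unfolding Jt_def Ju_def by auto
  \<comment> \<open>The set \<open>lost\<^sub>1\<close> matters for both chains, the other two only
    for the second. The matchings bound the first two; \<open>lost\<^sub>3\<close> simply takes all
    pairs between \<open>P\<close> and \<open>J\<close>. After doubling, the three bounds yield the
    terms p q / 2, q j and 2 p j.\<close>
  define lost\<^sub>1 where "lost\<^sub>1 = {e \<in> pairs C \<inter> H\<^sub>1. e \<inter> P \<noteq> {} \<and> e \<inter> Y \<noteq> {}}"
  define lost\<^sub>2 where "lost\<^sub>2 = {e \<in> pairs R \<inter> H\<^sub>2. e \<inter> U \<noteq> {} \<and> e \<inter> J \<noteq> {}}"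
  define lost\<^sub>3 where "lost\<^sub>3 = (\<lambda>(x, y). {x, y}) ` (P \<times> J)"
  have lost1: "card lost\<^sub>1 \<le> card M\<^sub>1 * (card Mr + 2)"
  proof -
    have "card lost\<^sub>1 \<le> card M\<^sub>1 * (card Y + 2)"
      unfolding lost\<^sub>1_def P_def using YU PU by (intro cross1) (auto simp: P_def)
    also have "\<dots> \<le> card M\<^sub>1 * (card Mr + 2)" using cardY by simp
    finally show ?thesis .
  qed
  have lost2: "card lost\<^sub>2 \<le> card M\<^sub>2 * (card J + 2)"
    unfolding lost\<^sub>2_def U_def using finU UJ by (intro cross2) (auto simp: U_def)
  have lost3: "card lost\<^sub>3 \<le> card P * card J"
    unfolding lost\<^sub>3_def using card_image_le[of "P \<times> J"] finP finU by (simp add: card_cartesian_product)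
  have fin_lost: "finite lost\<^sub>1" "finite lost\<^sub>2" "finite lost\<^sub>3"
    using finpC finite_pairs[OF finP(2)] finP finU unfolding lost\<^sub>1_def lost\<^sub>2_def lost\<^sub>3_def by auto
  have cP: "card P = 2 * card M\<^sub>1" and cU: "card U = 2 * card M\<^sub>2" using M1(4) M2(4) by (auto simp: P_def U_def)
  have cM2: "card M\<^sub>2 = card Mt + card Mr"
    using M_split finMt by (simp add: card_Un_disjoint)
  have cC: "card C = card P + card U + card J"
  proof -
    have "card C = card (P \<union> U) + card J"
      unfolding C_eq using finP finU PJ UJ by (intro card_Un_disjoint) auto
    also have "card (P \<union> U) = card P + card U"
      using finP finU PU by (intro card_Un_disjoint) auto
    finally show ?thesis .
  qed
  have cJ: "card J = 2 * card M\<^sub>3 + card Z"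
    using M3J finU M3(4) unfolding Z_def
    by (metis card_Diff_subset card_mono finite_subset le_add_diff_inverse)
  have M1Q: "M\<^sub>1 \<subseteq> Q\<^sub>1" using M1(1) by (auto simp: H\<^sub>1_def)
  have M2Q: "M\<^sub>2 \<subseteq> Q\<^sub>2" using M2(1) by (auto simp: H\<^sub>2_def)
  have M3Q: "M\<^sub>3 \<subseteq> Q\<^sub>3" using M3(1) pairs_J by (auto simp: H\<^sub>3_def)
  have split_H: "e \<in> H\<^sub>1 \<or> e \<in> H\<^sub>2 \<or> e \<in> H\<^sub>3" if "e \<in> pairs C" for e
    using that C(3) unfolding H\<^sub>1_def H\<^sub>2_def H\<^sub>3_def by auto
  have H1_meets: "\<exists>x y. e = {x, y} \<and> x \<in> P \<and> y \<in> C \<and> x \<noteq> y \<and> y \<in> V1" if e: "e \<in> pairs C" "e \<in> H\<^sub>1" for e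
  proof -
    obtain x y where xy: "e = {x, y}" "x \<in> C" "y \<in> C" "x \<noteq> y" using e(1) by (rule pairsE)
    have "x \<in> P \<or> y \<in> P" using max1[of e] e xy(1) by (auto simp: P_def)
    moreover have "x \<in> V1" "y \<in> V1" using e(2) xy(1) unfolding V1_def H\<^sub>1_def by auto
    ultimately show ?thesis using xy by (metis insert_commute)
  qed
  \<comment> \<open>The constant chain \<open>P\<close>: its pairs count whatever their colour, and
    one edge of round 0 pays for two vertices.\<close>
  have "real (card (pairs P)) \<le> L * (\<gamma> * card M\<^sub>1) + \<epsilon>"
  proof -
    have "pairs P = pairs P \<inter> H\<^sub>1 \<union> pairs (P \<union> {}) \<inter> H\<^sub>2 \<union> pairs (P \<union> {} \<union> {}) \<inter> H\<^sub>3"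
      using split_H pairs_mono[OF PC] by auto
    also have "real (card \<dots>) \<le> L * (\<gamma> * (card M\<^sub>1 + 0) + 0 + 0 + 2 * t * 0 + 0) + 0 + \<epsilon>"
      using few[of "card M\<^sub>1" 0 0 0 0 0 P "{}" "{}"] stageI[OF M1Q, of "{}" "\<Union>Q\<^sub>1"]
        empty_in_stage PC cP cC by (simp add: P_def)
    finally show ?thesis by simp
  qed
  then have ineq0: "real (card P) * (real (card P) - 1) \<le> L * (\<gamma> * card P) + 2 * \<epsilon>"
    unfolding card_pairs_real[OF finP(1)] cP by (simp add: algebra_simps)
  have cpC: "real (card (pairs C)) = real k * (real k - 1) / 2"
    unfolding k_def by (rule card_pairs_real[OF C(1)])
  define S where "S = pairs (P \<union> (\<Union>Mt \<union> Jt)) \<inter> H\<^sub>1 \<union> pairs (P \<union> (\<Union>Mt \<union> Jt) \<union> (\<Union>Mr \<union> Ju)) \<inter> H\<^sub>2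
      \<union> pairs (P \<union> (\<Union>Mt \<union> Jt) \<union> (\<Union>Mr \<union> Ju) \<union> {}) \<inter> H\<^sub>3"
  have C_eq': "P \<union> (\<Union>Mt \<union> Jt) \<union> (\<Union>Mr \<union> Ju) = C" unfolding C_eq U_split J_split(1) by auto
  have S_le: "real (card S) \<le> L * (\<gamma> * (card M\<^sub>1 + (2 * card Mt + card Jt)) + card Mr + card Ju)
      + (2 * card Mt + card Jt) + \<epsilon>"
  proof -
    have "card (\<Union>Mt \<union> Jt) = 2 * card Mt + card Jt"
    proof -
      have "finite (\<Union>Mt)" using U_split by (auto intro: finite_subset[OF _ finU(1)])
      moreover have "\<Union>Mt \<inter> Jt = {}" using U_split UJ J_split(1) by auto
      ultimately show ?thesis using J_split by (simp add: card_Un_disjoint cardMt)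
    qed
    moreover have "\<Union>Mt \<union> Jt \<subseteq> \<Union>Q\<^sub>1" unfolding Mt_def Jt_def V1_def by auto
    ultimately have D0: "P \<union> (\<Union>Mt \<union> Jt) \<in> stage Q\<^sub>1 (\<Union>Q\<^sub>1) (card M\<^sub>1) (2 * card Mt + card Jt)"
      using stageI[OF M1Q] unfolding P_def by metis
    have D1: "\<Union>Mr \<union> Ju \<in> stage Q\<^sub>2 W (card Mr) (card Ju)"
      using M2Q C_eq' C(2) by (intro stageI) (auto simp: Mr_def)
    have "{card M\<^sub>1, card Mr, 0, 2 * card Mt + card Jt, card Ju, 0} \<subseteq> {..card C}"
      using cC cP cU cM2 J_split(2) by auto
    moreover have "P \<union> (\<Union>Mt \<union> Jt) \<union> (\<Union>Mr \<union> Ju) \<union> {} \<subseteq> C" using C_eq' by simp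
    ultimately show ?thesis
      using few[OF _ _ D0 D1 empty_in_stage] unfolding S_def by simp
  qed
  \<comment> \<open>Only colour 0 pairs can be missed. Such a pair has one end in \<open>P\<close>
    and a touched other end, which lies either in the first set of the chain or in
    \<open>Y\<close>.\<close>
  have "pairs C \<subseteq> S \<union> lost\<^sub>1"
  proof
    fix e assume e: "e \<in> pairs C"
    show "e \<in> S \<union> lost\<^sub>1"
    proof (cases "e \<in> H\<^sub>1")
      case True
      then obtain x y where xy: "e = {x, y}" "x \<in> P" "y \<in> C" "x \<noteq> y" "y \<in> V1" using H1_meets e by blast
      show ?thesis
      proof (cases "y \<in> P \<union> (\<Union>Mt \<union> Jt)")
        case True
        then have "e \<in> pairs (P \<union> (\<Union>Mt \<union> Jt))" using xy by (auto simp: doubleton_in_pairs_iff)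
        then show ?thesis using \<open>e \<in> H\<^sub>1\<close> unfolding S_def by blast
      next
        case False
        then have "y \<in> Y" using xy C_eq' unfolding Y_def Ju_def by auto
        then show ?thesis using xy e \<open>e \<in> H\<^sub>1\<close> unfolding lost\<^sub>1_def by auto
      qed
    next
      case False
      then show ?thesis using split_H[OF e] e unfolding S_def C_eq' by auto
    qed
  qed
  moreover have "finite S"
    unfolding S_def by (intro finite_UnI finite_Int disjI1 finp) (use C_eq' in auto)
  ultimately have "card (pairs C) \<le> card S + card lost\<^sub>1"
    using fin_lost by (meson card_Un_le card_mono finite_UnI le_trans)
  then have "real k * (real k - 1) / 2 \<le> real (card S) + real (card M\<^sub>1 * (card Mr + 2))"
    using lost1 unfolding cpC[symmetric] by linarith
  also note S_le
  finally have A1: "real k * (real k - 1) / 2 \<le>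
      L * (\<gamma> * (card M\<^sub>1 + (2 * card Mt + card Jt)) + card Mr + card Ju)
      + (2 * card Mt + card Jt) + \<epsilon> + real (card M\<^sub>1 * (card Mr + 2))" by simp
  define S' where "S' = pairs (P \<union> \<Union>Mt) \<inter> H\<^sub>1 \<union> pairs (P \<union> \<Union>Mt \<union> \<Union>Mr) \<inter> H\<^sub>2
      \<union> pairs (P \<union> \<Union>Mt \<union> \<Union>Mr \<union> J) \<inter> H\<^sub>3"
  have C_eq'': "P \<union> \<Union>Mt \<union> \<Union>Mr \<union> J = C" unfolding C_eq U_split by auto
  have S'_le: "real (card S') \<le> L * (\<gamma> * (card M\<^sub>1 + 2 * card Mt) + card Mr + 2 * t * card M\<^sub>3 + card Z)
      + 2 * card Mt + \<epsilon>"
  proof -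
    have "\<Union>Mt \<subseteq> \<Union>Q\<^sub>1" unfolding Mt_def V1_def by auto
    then have D0: "P \<union> \<Union>Mt \<in> stage Q\<^sub>1 (\<Union>Q\<^sub>1) (card M\<^sub>1) (2 * card Mt)"
      using stageI[OF M1Q] cardMt unfolding P_def by metis
    have D1: "\<Union>Mr \<in> stage Q\<^sub>2 W (card Mr) 0"
      using stageI[of Mr Q\<^sub>2 "{}" W] M2Q by (auto simp: Mr_def)
    have D2: "J \<in> stage Q\<^sub>3 W (card M\<^sub>3) (card Z)"
    proof -
      have "J = \<Union>M\<^sub>3 \<union> Z" using M3J unfolding Z_def by auto
      moreover have "Z \<subseteq> W" using C(2) C_eq unfolding Z_def by auto
      ultimately show ?thesis using stageI[OF M3Q] by metis
    qed
    have "{card M\<^sub>1, card Mr, card M\<^sub>3, 2 * card Mt, 0, card Z} \<subseteq> {..card C}"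
      using cC cP cU cM2 cJ by auto
    moreover have "P \<union> \<Union>Mt \<union> \<Union>Mr \<union> J \<subseteq> C" using C_eq'' by simp
    ultimately show ?thesis
      using few[OF _ _ D0 D1 D2] unfolding S'_def by simp
  qed
  \<comment> \<open>A missed colour 0 pair joins \<open>P\<close> to \<open>Y\<close> or to
    \<open>J\<close>. A missed colour 1 pair has an end in \<open>J\<close>; its other end is in
    \<open>P\<close> or, by maximality of \<open>M\<^sub>2\<close>, in \<open>U\<close>. Colour 2
    pairs are all counted.\<close>
  have "pairs C \<subseteq> S' \<union> lost\<^sub>1 \<union> lost\<^sub>2 \<union> lost\<^sub>3"
  proof
    fix e assume e: "e \<in> pairs C"
    consider "e \<in> H\<^sub>1" | "e \<in> H\<^sub>2" | "e \<in> H\<^sub>3" using split_H[OF e] by blast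
    then show "e \<in> S' \<union> lost\<^sub>1 \<union> lost\<^sub>2 \<union> lost\<^sub>3"
    proof cases
      case 1
      then obtain x y where xy: "e = {x, y}" "x \<in> P" "y \<in> C" "x \<noteq> y" "y \<in> V1" using H1_meets e by blast
      consider "y \<in> P \<union> \<Union>Mt" | "y \<in> \<Union>Mr" | "y \<in> J" using xy(3) C_eq'' by blast
      then show ?thesis
      proof cases
        case 1
        then have "e \<in> pairs (P \<union> \<Union>Mt)" using xy by (auto simp: doubleton_in_pairs_iff)
        then show ?thesis using \<open>e \<in> H\<^sub>1\<close> unfolding S'_def by blast
      next
        case 2
        then have "y \<in> Y" using xy unfolding Y_def by auto
        then show ?thesis using xy e \<open>e \<in> H\<^sub>1\<close> unfolding lost\<^sub>1_def by auto
      next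
        case 3
        then show ?thesis using xy unfolding lost\<^sub>3_def by auto
      qed
    next
      case 2
      show ?thesis
      proof (cases "e \<inter> J = {}")
        case True
        then have "e \<in> pairs (P \<union> \<Union>Mt \<union> \<Union>Mr)" using e C_eq'' unfolding pairs_def by auto
        then show ?thesis using 2 unfolding S'_def by blast
      next
        case False
        then obtain x y where xy: "e = {x, y}" "x \<in> C" "y \<in> J" "x \<noteq> y"
          using e by (elim pairsE) (auto simp: insert_commute)
        show ?thesis
        proof (cases "x \<in> P")
          case True
          then show ?thesis using xy unfolding lost\<^sub>3_def by auto
        next
          case False
          then have "e \<in> pairs R \<inter> H\<^sub>2"
            using xy 2 by (auto simp: doubleton_in_pairs_iff R_def J_def)
          then show ?thesis using max2[of e] xy unfolding lost\<^sub>2_def U_def by auto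
        qed
      qed
    next
      case 3
      then show ?thesis using e unfolding S'_def C_eq'' by auto
    qed
  qed
  moreover have "finite S'"
    unfolding S'_def by (intro finite_UnI finite_Int disjI1 finp) (use C_eq'' in auto)
  ultimately have "card (pairs C) \<le> card (S' \<union> lost\<^sub>1 \<union> lost\<^sub>2 \<union> lost\<^sub>3)"
    using fin_lost by (intro card_mono) auto
  also have "\<dots> \<le> card S' + card lost\<^sub>1 + card lost\<^sub>2 + card lost\<^sub>3"
    by (meson add_le_mono1 card_Un_le le_trans)
  finally have "real k * (real k - 1) / 2 \<le> real (card S') + real (card M\<^sub>1 * (card Mr + 2))
      + real (card M\<^sub>2 * (card J + 2)) + real (card P * card J)"
    using lost1 lost2 lost3 unfolding cpC[symmetric] by linarith
  also note S'_le
  finally have B1: "real k * (real k - 1) / 2 \<le>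
      L * (\<gamma> * (card M\<^sub>1 + 2 * card Mt) + card Mr + 2 * t * card M\<^sub>3 + card Z)
      + 2 * card Mt + \<epsilon> + real (card M\<^sub>1 * (card Mr + 2))
      + real (card M\<^sub>2 * (card J + 2)) + real (card P * card J)" by simp
  have half: "\<gamma> * x \<le> x / 2" if "0 \<le> x" for x
    using mult_right_mono[OF param(3) that] by simp
  have mono: "card M\<^sub>1 * (card Mr + 2) \<le> card M\<^sub>1 * (card M\<^sub>2 + 2)" using cM2 by simp
  show ?thesis
  proof (rule that[of "card P" "card U" "card J"])
    show "card P + card U + card J = card C" using cC by simp
    show "real (card P) * (real (card P) - 1) \<le> L * (\<gamma> * card P) + 2 * \<epsilon>" by (rule ineq0)
    \<comment> \<open>By \<gamma> \<le> 1/2, an edge of \<open>Mt\<close> and a vertex of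
      \<open>Jt\<close> may both be charged 1. The later term \<open>5 * card C\<close> consists of
      k from k (k - 1), 2 k from doubling the \<open>b0\<close> summand, and 2 k from the additive 2
      in the bounds on lost pairs.\<close>
    have "\<gamma> * (card M\<^sub>1 + (2 * card Mt + card Jt)) + card Mr + card Ju
        \<le> \<gamma> * card M\<^sub>1 + card M\<^sub>2 + card J"
      using half[of "2 * card Mt"] half[of "card Jt"] cM2 J_split(2) by (simp add: algebra_simps)
    then have "L * (\<gamma> * (card M\<^sub>1 + (2 * card Mt + card Jt)) + card Mr + card Ju)
        \<le> L * (\<gamma> * card M\<^sub>1 + card M\<^sub>2 + card J)" using param(1) by (rule mult_left_mono)
    then have "real k * (real k - 1) / 2 \<le> L * (\<gamma> * card M\<^sub>1 + card M\<^sub>2 + card J)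
      + k + \<epsilon> + real (card M\<^sub>1 * (card M\<^sub>2 + 2))"
      using A1 mono cC cU cM2 J_split(2) unfolding k_def by linarith
    then show "(real (card C))\<^sup>2 \<le> L * (\<gamma> * card P + card U + 2 * card J) + real (card P) * card U / 2
        + 5 * card C + 2 * \<epsilon>"
      using cC unfolding k_def cP cU by (simp add: power2_eq_square algebra_simps)
    \<comment> \<open>The vertex of \<open>Z\<close>, if there is one, costs L; doubled, this is the
      summand 2 L of the conclusion.\<close>
    have "2 * t * card M\<^sub>3 \<le> t * card J"
      using param(4) cJ by (simp add: algebra_simps)
    then have "\<gamma> * (card M\<^sub>1 + 2 * card Mt) + card Mr + 2 * t * card M\<^sub>3 + card Z
        \<le> \<gamma> * card M\<^sub>1 + card M\<^sub>2 + t * card J + 1"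
      using half[of "2 * card Mt"] cM2 cardZ by (simp add: algebra_simps)
    then have "L * (\<gamma> * (card M\<^sub>1 + 2 * card Mt) + card Mr + 2 * t * card M\<^sub>3 + card Z)
        \<le> L * (\<gamma> * card M\<^sub>1 + card M\<^sub>2 + t * card J + 1)" using param(1) by (rule mult_left_mono)
    then have "real k * (real k - 1) / 2 \<le> L * (\<gamma> * card M\<^sub>1 + card M\<^sub>2 + t * card J + 1)
      + k + \<epsilon> + real (card M\<^sub>1 * (card M\<^sub>2 + 2)) + real (card M\<^sub>2 * (card J + 2)) + real (card P * card J)"
      using B1 mono cC cU cM2 unfolding k_def by linarith
    then show "(real (card C))\<^sup>2 \<le> L * (\<gamma> * card P + card U + 2 * t * card J) + real (card P) * card U / 2
       + 2 * real (card P) * card J + real (card U) * card J + 5 * card C + 2 * L + 2 * \<epsilon>"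
      using cC unfolding k_def cP cU by (simp add: power2_eq_square algebra_simps)
  qed
qed

section \<open>The inequalities between the parts of a clique\<close>

text \<open>Were the total k above 1 + t, the second inequality together with (k - 1)^2 \<ge> t^2
  would give q \<le> 2 w for the deficit w = 1 - t - p. Then the difference \<open>g\<close> of the
  sides of the third inequality, as a function of the total, is nonnegative at 1 + t and strictly
  larger at k, a contradiction. Equality is attained at p = 1 - t, q = 0, j = 2 t.\<close>

lemma clique_weight_le:
  fixes p q j t :: real
  assumes t: "1/2 \<le> t" "t < 1" and nonneg: "0 \<le> p" "0 \<le> q" "0 \<le> j"
    and p: "p\<^sup>2 \<le> (1 - t) * p"
    and A: "(p + q + j)\<^sup>2 \<le> (1 - t) * p + q + p * q / 2 + 2 * j"
    and B: "(p + q + j)\<^sup>2 \<le> (1 - t) * p + q + p * q / 2 + 2 * t * j + 2 * p * j + q * j"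
  shows "p + q + j \<le> 1 + t"
proof (rule ccontr)
  assume "\<not> p + q + j \<le> 1 + t"
  then have k: "p + q + j > 1 + t" by simp
  define k where "k = p + q + j"
  have j: "j = k - p - q" by (simp add: k_def)
  have kt: "k > 1 + t" using k by (simp add: k_def)
  have p': "p \<le> 1 - t"
    using p nonneg(1) by (cases "p = 0") (use t in \<open>auto simp: power2_eq_square mult_le_cancel_right\<close>)
  define w where "w = 1 - t - p"
  have w: "0 \<le> w" "w \<le> 1 - t" "p = 1 - t - w" using p' nonneg by (auto simp: w_def)
  have "(k - 1)\<^sup>2 \<ge> t\<^sup>2" using kt t by (intro power_mono) auto
  then have "q * (2 - p) \<le> 2 * (1 + t) * w"
    using A unfolding j w_def by (simp add: power2_eq_square algebra_simps)
  then have "q * (1 + t) + q * w \<le> 2 * w * (1 + t)"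
    unfolding w(3) by (simp add: algebra_simps)
  moreover have "0 \<le> q * w" using nonneg w by simp
  ultimately have "q * (1 + t) \<le> (2 * w) * (1 + t)" by linarith
  then have q: "q \<le> 2 * w" using t by (simp add: mult_le_cancel_right)
  define g where "g x = x\<^sup>2 - (1 - t) * p - q - p * q / 2 - (2 * t + 2 * p + q) * (x - p - q)" for x
  have "g k \<le> 0" using B unfolding g_def j by (simp add: power2_eq_square algebra_simps)
  moreover have "g k - g (1 + t) = (k - (1 + t)) * (k + (1 + t) - 2 * t - 2 * p - q)"
    unfolding g_def by (simp add: power2_eq_square algebra_simps)
  moreover have "(k - (1 + t)) * (k + (1 + t) - 2 * t - 2 * p - q) > 0"
    using kt q w t by (intro mult_pos_pos) auto
  moreover have "g (1 + t) = (w - q / 2) * (3 * t - 1 + 2 * w - 3 / 2 * q) + q\<^sup>2 / 4"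
    unfolding g_def w(3) by (simp add: power2_eq_square field_simps)
  \<comment> \<open>From q \<le> 2 w and w \<le> 1 - t the second factor is at least 4 t - 2, which
    is nonnegative as t \<ge> 1/2.\<close>
  moreover have "(w - q / 2) * (3 * t - 1 + 2 * w - 3 / 2 * q) \<ge> 0"
    using q w t by (intro mult_nonneg_nonneg) auto
  moreover have "q\<^sup>2 / 4 \<ge> 0" by simp
  ultimately show False by linarith
qed

lemma clique_weight_gap:
  fixes t \<kappa>\<^sub>1 \<kappa>\<^sub>2 :: real
  assumes t: "1/2 \<le> t" "t < 1" and \<kappa>: "1 + t < \<kappa>\<^sub>1" "\<kappa>\<^sub>1 \<le> \<kappa>\<^sub>2"
  obtains \<epsilon> where "\<epsilon> > 0"
    "\<And>p q j. 0 \<le> p \<Longrightarrow> 0 \<le> q \<Longrightarrow> 0 \<le> j \<Longrightarrow> \<kappa>\<^sub>1 \<le> p + q + j \<Longrightarrow> p + q + j \<le> \<kappa>\<^sub>2 \<Longrightarrow>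
       p\<^sup>2 \<le> (1 - t) * p + \<epsilon> \<Longrightarrow>
       (p + q + j)\<^sup>2 \<le> (1 - t) * p + q + p * q / 2 + 2 * j + \<epsilon> \<Longrightarrow>
       (p + q + j)\<^sup>2 \<le> (1 - t) * p + q + p * q / 2 + 2 * t * j + 2 * p * j + q * j + \<epsilon> \<Longrightarrow> False"
proof -
  define f :: "real \<times> real \<times> real \<Rightarrow> real" where
    "f = (\<lambda>(p, q, j). max (p\<^sup>2 - (1 - t) * p)
      (max ((p + q + j)\<^sup>2 - ((1 - t) * p + q + p * q / 2 + 2 * j))
        ((p + q + j)\<^sup>2 - ((1 - t) * p + q + p * q / 2 + 2 * t * j + 2 * p * j + q * j))))"
  define K where "K = ({0..\<kappa>\<^sub>2} \<times> {0..\<kappa>\<^sub>2} \<times> {0..\<kappa>\<^sub>2}) \<inter>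
    {z. \<kappa>\<^sub>1 \<le> fst z + fst (snd z) + snd (snd z)}"
  have "compact K" unfolding K_def
    by (intro compact_Int_closed compact_Times compact_Icc closed_Collect_le continuous_intros)
  moreover have "(\<kappa>\<^sub>1, 0, 0) \<in> K" using t \<kappa> by (auto simp: K_def)
  then have "K \<noteq> {}" by blast
  moreover have "continuous_on K f" unfolding f_def case_prod_beta
    by (intro continuous_intros) auto
  ultimately obtain z where z: "z \<in> K" "\<And>y. y \<in> K \<Longrightarrow> f z \<le> f y"
    using continuous_attains_inf by metis
  have pos: "f y > 0" if "y \<in> K" for y
  proof (rule ccontr)
    obtain p q j where y: "y = (p, q, j)" by (cases y)
    assume "\<not> f y > 0"
    then have "p + q + j \<le> 1 + t"
      using that t unfolding y f_def K_def by (intro clique_weight_le) auto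
    then show False using that \<kappa> unfolding y K_def by auto
  qed
  show ?thesis
  proof (rule that[of "f z / 2"])
    show "f z / 2 > 0" using pos z by simp
  next
    fix p q j :: real
    assume a: "0 \<le> p" "0 \<le> q" "0 \<le> j" "\<kappa>\<^sub>1 \<le> p + q + j" "p + q + j \<le> \<kappa>\<^sub>2"
      and b: "p\<^sup>2 \<le> (1 - t) * p + f z / 2"
       "(p + q + j)\<^sup>2 \<le> (1 - t) * p + q + p * q / 2 + 2 * j + f z / 2"
       "(p + q + j)\<^sup>2 \<le> (1 - t) * p + q + p * q / 2 + 2 * t * j + 2 * p * j + q * j + f z / 2"
    have "(p, q, j) \<in> K" using a by (auto simp: K_def)
    then have "f z \<le> f (p, q, j)" by (rule z)
    also have "f (p, q, j) = max (p\<^sup>2 - (1 - t) * p)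
      (max ((p + q + j)\<^sup>2 - ((1 - t) * p + q + p * q / 2 + 2 * j))
        ((p + q + j)\<^sup>2 - ((1 - t) * p + q + p * q / 2 + 2 * t * j + 2 * p * j + q * j)))"
      by (simp add: f_def)
    also have "\<dots> \<le> f z / 2" using b by (intro max.boundedI) linarith+
    finally show False using pos[OF z(1)] by simp
  qed
qed

section \<open>From discovered cliques to chain events and normalised sizes\<close>

lemma mem_scheme_event_stagesI:
  assumes D: "D0 \<in> stage (queries S G 0) (\<Union>(queries S G 0)) a0 b0"
      "D1 \<in> stage (queries S G 1) {..<n} a1 b1" "D2 \<in> stage (queries S G 2) {..<n} a2 b2"
    and R: "R = pairs D0 \<inter> queries S G 0 \<union> pairs (D0 \<union> D1) \<inter> (queries S G 1 - queries S G 0)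
      \<union> pairs (D0 \<union> D1 \<union> D2) \<inter> (queries S G 2 - (queries S G 0 \<union> queries S G 1))"
      "R \<subseteq> G" "m \<le> card R"
  shows "G \<in> scheme_event S 3 (stages S n [a0, a1, a2] [b0, b1, b2]) m"
proof -
  define D where "D i = [D0, D1, D2] ! i" for i
  have less3: "i < 3 \<longleftrightarrow> i = 0 \<or> i = 1 \<or> i = 2" for i :: nat by auto
  have nonempty: "history S G 1 \<noteq> []" "history S G 2 \<noteq> []"
    using length_history[of S G 1] length_history[of S G 2] by auto
  have "D i \<in> stages S n [a0, a1, a2] [b0, b1, b2] (history S G i)" if i: "i < 3" for i
  proof -
    consider "i = 0" | "i = 1" | "i = 2" using i unfolding less3 by blast
    then show ?thesis
    proof cases
      case 1
      then show ?thesis using D(1) by (simp add: D_def stages_def queries_def)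
    next
      case 2
      then show ?thesis using D(2) nonempty(1) length_history[of S G 1]
        by (simp add: D_def stages_def queries_def)
    next
      case 3
      then show ?thesis using D(3) nonempty(2) length_history[of S G 2]
        by (simp add: D_def stages_def queries_def)
    qed
  qed
  moreover have "(\<Union>i<3. pairs (\<Union>j\<le>i. D j) \<inter> fresh_queries S G i) = R"
  proof -
    have "{..<3} = {0, 1, 2::nat}" "{..<2} = {0, 1::nat}" "{..<1} = {0::nat}"
      "{..0} = {0::nat}" "{..1} = {0, 1::nat}" "{..2} = {0, 1, 2::nat}" by auto
    then show ?thesis unfolding R(1) fresh_queries_def D_def by (simp add: Un_assoc)
  qed
  ultimately show ?thesis using R unfolding scheme_event_def by blast
qed

lemma discovered_clique_pairs:
  assumes "clique n (discovered_graph S 3 G) C"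
  shows "C \<subseteq> {..<n}" "pairs C \<subseteq> G" "pairs C \<subseteq> queries S G 0 \<union> queries S G 1 \<union> queries S G 2"
proof -
  show "C \<subseteq> {..<n}" using assms by (simp add: clique_def)
  have "e \<in> discovered_graph S 3 G" if "e \<in> pairs C" for e
    using that assms by (elim pairsE) (auto simp: clique_def)
  moreover have "{..<3} = {0, 1, 2::nat}" by auto
  ultimately show "pairs C \<subseteq> G" "pairs C \<subseteq> queries S G 0 \<union> queries S G 1 \<union> queries S G 2"
    unfolding discovered_graph_def by auto
qed

text \<open>Division by L^2. Since p + q + j \<le> 2 L, the lower order terms add up to at most 12
  L, which 24 \<le> \<epsilon> L turns into half of the error \<epsilon> L^2. The other half is
  twice the slack (\<epsilon> / 4) L^2.\<close>

lemma clique_scaled_inequalities: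
  fixes p q j L \<gamma> t \<epsilon> :: real
  assumes L: "0 < L" "24 \<le> \<epsilon> * L" and pqj: "0 \<le> p" "0 \<le> q" "0 \<le> j" "p + q + j \<le> 2 * L"
    and I: "p * (p - 1) \<le> L * (\<gamma> * p) + 2 * (\<epsilon> / 4 * L\<^sup>2)"
      "(p + q + j)\<^sup>2 \<le> L * (\<gamma> * p + q + 2 * j) + p * q / 2 + 5 * (p + q + j) + 2 * (\<epsilon> / 4 * L\<^sup>2)"
      "(p + q + j)\<^sup>2 \<le> L * (\<gamma> * p + q + 2 * t * j) + p * q / 2 + 2 * p * j + q * j
         + 5 * (p + q + j) + 2 * L + 2 * (\<epsilon> / 4 * L\<^sup>2)"
  shows "(p / L)\<^sup>2 \<le> \<gamma> * (p / L) + \<epsilon>"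
    "(p / L + q / L + j / L)\<^sup>2 \<le> \<gamma> * (p / L) + q / L + (p / L) * (q / L) / 2 + 2 * (j / L) + \<epsilon>"
    "(p / L + q / L + j / L)\<^sup>2 \<le> \<gamma> * (p / L) + q / L + (p / L) * (q / L) / 2 + 2 * t * (j / L)
       + 2 * (p / L) * (j / L) + (q / L) * (j / L) + \<epsilon>"
proof -
  define x y z where "x = p / L" and "y = q / L" and "z = j / L"
  have eq: "p = L * x" "q = L * y" "j = L * z" using L by (auto simp: x_def y_def z_def)
  have "24 * L \<le> \<epsilon> * L * L" using L by (intro mult_right_mono) auto
  then have slack: "12 * L \<le> \<epsilon> * L\<^sup>2 / 2" by (simp add: power2_eq_square)
  have quarter: "2 * (\<epsilon> / 4 * L\<^sup>2) = \<epsilon> * L\<^sup>2 / 2" by simp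
  have absorb: "a \<le> b + e" if "a \<le> b + 5 * s + c + e / 2" "12 * L \<le> e / 2" "s \<le> 2 * L" "c \<le> 2 * L"
    for a b c e s :: real
    using that by linarith
  have cancel: "u \<le> v" if "L\<^sup>2 * u \<le> L\<^sup>2 * v" for u v using that L by simp
  have p_le: "p \<le> 2 * L" using pqj by linarith
  have "L\<^sup>2 * x\<^sup>2 \<le> L\<^sup>2 * (\<gamma> * x + \<epsilon>)"
  proof -
    have "p\<^sup>2 \<le> L * (\<gamma> * p) + \<epsilon> * L\<^sup>2" 
    proof -
      have "p * (p - 1) = p\<^sup>2 - p" by (simp add: power2_eq_square algebra_simps)
      then show ?thesis using I(1)[unfolded quarter] slack p_le L by linarith
    qed
    then show ?thesis unfolding eq by (simp add: power2_eq_square algebra_simps)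
  qed
  moreover have "L\<^sup>2 * (x + y + z)\<^sup>2 \<le> L\<^sup>2 * (\<gamma> * x + y + x * y / 2 + 2 * z + \<epsilon>)"
  proof -
    have "(p + q + j)\<^sup>2 \<le> L * (\<gamma> * p + q + 2 * j) + p * q / 2 + \<epsilon> * L\<^sup>2"
    proof (rule absorb[OF _ slack pqj(4)])
      show "(p + q + j)\<^sup>2 \<le> L * (\<gamma> * p + q + 2 * j) + p * q / 2 + 5 * (p + q + j) + 0 + \<epsilon> * L\<^sup>2 / 2"
        using I(2)[unfolded quarter] by (simp only: add_0_right)
    qed (use L in simp)
    then show ?thesis unfolding eq by (simp add: power2_eq_square algebra_simps)
  qed
  moreover have "L\<^sup>2 * (x + y + z)\<^sup>2 \<le> L\<^sup>2 * (\<gamma> * x + y + x * y / 2 + 2 * t * z + 2 * x * z + y * z + \<epsilon>)"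
  proof -
    have "(p + q + j)\<^sup>2 \<le> L * (\<gamma> * p + q + 2 * t * j) + p * q / 2 + 2 * p * j + q * j + \<epsilon> * L\<^sup>2"
      by (rule absorb[OF I(3)[unfolded quarter] slack pqj(4) order_refl])
    then show ?thesis unfolding eq by (simp add: power2_eq_square algebra_simps)
  qed
  ultimately show "(p / L)\<^sup>2 \<le> \<gamma> * (p / L) + \<epsilon>"
    "(p / L + q / L + j / L)\<^sup>2 \<le> \<gamma> * (p / L) + q / L + (p / L) * (q / L) / 2 + 2 * (j / L) + \<epsilon>"
    "(p / L + q / L + j / L)\<^sup>2 \<le> \<gamma> * (p / L) + q / L + (p / L) * (q / L) / 2 + 2 * t * (j / L)
       + 2 * (p / L) * (j / L) + (q / L) * (j / L) + \<epsilon>"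
    unfolding x_def[symmetric] y_def[symmetric] z_def[symmetric] by (blast intro: cancel)+
qed

section \<open>The upper bound\<close>

text \<open>Without queries the empty clique is still found; this makes the set in
  \<open>alpha_star\<close> nonempty, as \<open>cSup_least\<close> requires.\<close>

lemma exists_trivial_clique_algorithm:
  assumes "length \<delta>s = l" "\<forall>i<l. 0 < \<delta>s ! i \<and> \<delta>s ! i < 2"
  shows "clique_algorithm \<delta>s l 0 (\<lambda>n h. {})"
proof -
  have "clique n E {}" for n E by (simp add: clique_def)
  then have "{G. \<exists>C. clique n (discovered_graph (\<lambda>h. {}) l G) C \<and> real (card C) \<ge> 0 * log 2 (real n) - 0} = UNIV"
    for n by (auto intro!: exI[of _ "{}"])
  then show ?thesis
    unfolding clique_algorithm_def using assms
    by (intro conjI exI[of _ "\<lambda>_. 0"]) (auto simp: queries_def)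
qed

lemma clique_algorithm_le:
  assumes \<delta>: "1 \<le> \<delta>" "\<delta> < 2" and A: "clique_algorithm [1 - \<delta> / 2, 1, \<delta>] 3 \<alpha> A"
  shows "\<alpha> \<le> 1 + \<delta> / 2"
proof (rule ccontr)
  assume "\<not> \<alpha> \<le> 1 + \<delta> / 2"
  then have \<alpha>: "\<alpha> > 1 + \<delta> / 2" by simp
  define t where "t = \<delta> / 2"
  have t: "1/2 \<le> t" "t < 1" "\<delta> = 2 * t" using \<delta> by (auto simp: t_def)
  \<comment> \<open>The midpoint leaves a gap (\<alpha> - \<kappa>) L, which absorbs the error term
    \<open>g\<close> and, separately, the rounding up in \<open>k\<close>.\<close>
  define \<kappa> where "\<kappa> = (1 + t + \<alpha>) / 2"
  have \<kappa>: "1 + t < \<kappa>" "\<kappa> < \<alpha>" using \<alpha> by (auto simp: \<kappa>_def t_def)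
  have \<alpha>2: "\<alpha> \<le> 2" using A by (simp add: clique_algorithm_def)
  have Q: "queries (A n) G i \<subseteq> vertex_pairs n \<and>
      real (card (queries (A n) G i)) \<le> real n powr ([1 - t, 1, 2 * t] ! i)"
    if "G \<subseteq> vertex_pairs n" "i < 3" for n G i
    using A that t(3) unfolding clique_algorithm_def by simp
  obtain g where g: "g \<in> o(\<lambda>n. log 2 (real n))"
    and prob: "\<forall>\<^sub>F n in sequentially. measure_pmf.prob (random_graph n)
             {G. \<exists>C. clique n (discovered_graph (A n) 3 G) C \<and>
                     real (card C) \<ge> \<alpha> * log 2 (real n) - g n} \<ge> 1/2"
    using A unfolding clique_algorithm_def by blast
  obtain \<epsilon> where \<epsilon>: "\<epsilon> > 0" and gap:
    "\<And>p q j. 0 \<le> p \<Longrightarrow> 0 \<le> q \<Longrightarrow> 0 \<le> j \<Longrightarrow> \<kappa> \<le> p + q + j \<Longrightarrow> p + q + j \<le> \<alpha> \<Longrightarrow>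
       p\<^sup>2 \<le> (1 - t) * p + \<epsilon> \<Longrightarrow>
       (p + q + j)\<^sup>2 \<le> (1 - t) * p + q + p * q / 2 + 2 * j + \<epsilon> \<Longrightarrow>
       (p + q + j)\<^sup>2 \<le> (1 - t) * p + q + p * q / 2 + 2 * t * j + 2 * p * j + q * j + \<epsilon> \<Longrightarrow> False"
    using clique_weight_gap[OF t(1,2) \<kappa>(1), of \<alpha>] \<kappa>(2) by (metis less_imp_le)
  have "\<forall>\<^sub>F n in sequentially. norm (g n) \<le> (\<alpha> - \<kappa>) * norm (log 2 (real n))"
    using landau_o.smallD[OF g] \<kappa>(2) by simp
  moreover have "\<forall>\<^sub>F n in sequentially. 24 / \<epsilon> \<le> log 2 (real n)"
    "\<forall>\<^sub>F n in sequentially. 1 / (\<alpha> - \<kappa>) \<le> log 2 (real n)"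
    "\<forall>\<^sub>F n in sequentially. 1 \<le> log 2 (real n)"
    by real_asymp+
  \<comment> \<open>A chain has six parameters, each at most k \<le> 2 L; this is the factor with
    exponent 6 in the final union bound.\<close>
  moreover have "\<forall>\<^sub>F n in sequentially.
      (2 * log 2 (real n) + 1) ^ 6 * 2 powr (- (\<epsilon> / 4 * (log 2 (real n))\<^sup>2)) < 1 / 2"
    using \<epsilon> by real_asymp
  ultimately have "\<forall>\<^sub>F n in sequentially. norm (g n) \<le> (\<alpha> - \<kappa>) * norm (log 2 (real n)) \<and>
      24 / \<epsilon> \<le> log 2 (real n) \<and> 1 / (\<alpha> - \<kappa>) \<le> log 2 (real n) \<and> 1 \<le> log 2 (real n) \<and>
      (2 * log 2 (real n) + 1) ^ 6 * 2 powr (- (\<epsilon> / 4 * (log 2 (real n))\<^sup>2)) < 1 / 2 \<and>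
      measure_pmf.prob (random_graph n) {G. \<exists>C. clique n (discovered_graph (A n) 3 G) C \<and>
        real (card C) \<ge> \<alpha> * log 2 (real n) - g n} \<ge> 1/2"
    using prob by eventually_elim blast
  then obtain n where n: "norm (g n) \<le> (\<alpha> - \<kappa>) * norm (log 2 (real n))"
      "24 / \<epsilon> \<le> log 2 (real n)" "1 / (\<alpha> - \<kappa>) \<le> log 2 (real n)" "1 \<le> log 2 (real n)"
      "(2 * log 2 (real n) + 1) ^ 6 * 2 powr (- (\<epsilon> / 4 * (log 2 (real n))\<^sup>2)) < 1 / 2"
      "measure_pmf.prob (random_graph n) {G. \<exists>C. clique n (discovered_graph (A n) 3 G) C \<and>
        real (card C) \<ge> \<alpha> * log 2 (real n) - g n} \<ge> 1/2"
    using eventually_happens'[OF sequentially_bot] by blast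
  define L where "L = log 2 (real n)"
  define S where "S = A n"
  define V where "V = vertex_pairs n"
  define k where "k = nat \<lceil>\<kappa> * L\<rceil>"
  define Ev where "Ev = {G. \<exists>C. clique n (discovered_graph S 3 G) C \<and> real (card C) \<ge> \<alpha> * L - g n}"
  have L: "1 \<le> L" "24 \<le> \<epsilon> * L" "1 \<le> (\<alpha> - \<kappa>) * L"
    using n(2-4) \<epsilon> \<kappa>(2) by (auto simp: L_def field_simps)
  have "n \<noteq> 0"
  proof
    assume "n = 0"
    \<comment> \<open>The default value ln 0 = 0 would make L zero.\<close>
    then show False using L(1) by (simp add: L_def log_def)
  qed
  then have n1: "n \<ge> 1" by simp
  have k: "\<kappa> * L \<le> real k" "real k \<le> \<alpha> * L" "real k \<le> 2 * L"
  proof -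
    have "0 \<le> \<kappa> * L" using \<kappa> t L by simp
    then have "\<kappa> * L \<le> real k" "real k \<le> \<kappa> * L + 1" unfolding k_def by linarith+
    then show "\<kappa> * L \<le> real k" "real k \<le> \<alpha> * L" using L(3) by (auto simp: algebra_simps)
    then show "real k \<le> 2 * L" using mult_right_mono[OF \<alpha>2, of L] L(1) by linarith
  qed
  have gn: "\<alpha> * L - g n \<ge> \<kappa> * L"
    using n(1) L(1) by (auto simp: L_def algebra_simps abs_le_iff)
  \<comment> \<open>The bound on the logarithm of the number of chains plus (\<epsilon> / 4) L^2, so
    that each bad event has probability at most 2 to the power -(\<epsilon> / 4) L^2.\<close>
  define cost where "cost = (\<lambda>(a0, a1, a2, b0, b1, b2).
    L * ((1 - t) * (real a0 + real b0) + real a1 + real b1 + 2 * t * real a2 + real b2) + real b0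
      + \<epsilon> / 4 * L\<^sup>2)"
  define Bad where "Bad = (\<lambda>(a0, a1, a2, b0, b1, b2). scheme_event S 3
    (stages S n [a0, a1, a2] [b0, b1, b2]) (nat \<lceil>cost (a0, a1, a2, b0, b1, b2)\<rceil>))"
  define I where "I = {..k} \<times> {..k} \<times> {..k} \<times> {..k} \<times> {..k} \<times> {..k}"
  \<comment> \<open>Outside the bad events every chain in a large clique satisfies the premise
    \<open>few\<close> of \<open>clique_decomposition\<close>, and the resulting inequalities
    contradict \<open>gap\<close>.\<close>
  have "Pow V \<inter> Ev \<subseteq> Pow V \<inter> (\<Union>\<tau>\<in>I. Bad \<tau>)"
  proof (rule ccontr)
    assume "\<not> ?thesis"
    then obtain G where G: "G \<subseteq> V" "G \<in> Ev" "\<And>\<tau>. \<tau> \<in> I \<Longrightarrow> G \<notin> Bad \<tau>" by blast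
    obtain C' where C': "clique n (discovered_graph S 3 G) C'" "real (card C') \<ge> \<alpha> * L - g n"
      using G(2) by (auto simp: Ev_def)
    then have "k \<le> card C'" using gn unfolding k_def by linarith
    \<comment> \<open>Trimming to exactly \<open>k\<close> vertices keeps the chain parameters in
      the range of \<open>I\<close> and the normalised size below the upper limit \<alpha> in
      \<open>gap\<close>.\<close>
    then obtain C where C: "C \<subseteq> C'" "card C = k" by (rule obtain_subset_with_card_n)
    have C_props: "C \<subseteq> {..<n}" "pairs C \<subseteq> G" "pairs C \<subseteq> queries S G 0 \<union> queries S G 1 \<union> queries S G 2"
      using discovered_clique_pairs[OF C'(1)] C(1) pairs_mono[OF C(1)] by blast+
    have finC: "finite C" using C_props(1) by (rule finite_subset) simp
    have few: "real (card (pairs D0 \<inter> queries S G 0 \<union> pairs (D0 \<union> D1) \<inter> (queries S G 1 - queries S G 0)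
        \<union> pairs (D0 \<union> D1 \<union> D2) \<inter> (queries S G 2 - (queries S G 0 \<union> queries S G 1))))
      \<le> L * ((1 - t) * (a0 + b0) + a1 + b1 + 2 * t * a2 + b2) + b0 + \<epsilon> / 4 * L\<^sup>2"
      if le: "{a0, a1, a2, b0, b1, b2} \<subseteq> {..card C}" and D: "D0 \<union> D1 \<union> D2 \<subseteq> C"
        "D0 \<in> stage (queries S G 0) (\<Union>(queries S G 0)) a0 b0"
        "D1 \<in> stage (queries S G 1) {..<n} a1 b1" "D2 \<in> stage (queries S G 2) {..<n} a2 b2"
      for a0 a1 a2 b0 b1 b2 D0 D1 D2
    proof (rule ccontr)
      define R where "R = pairs D0 \<inter> queries S G 0 \<union> pairs (D0 \<union> D1) \<inter> (queries S G 1 - queries S G 0)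
        \<union> pairs (D0 \<union> D1 \<union> D2) \<inter> (queries S G 2 - (queries S G 0 \<union> queries S G 1))"
      assume "\<not> ?thesis"
      then have "real (card R) > cost (a0, a1, a2, b0, b1, b2)" unfolding R_def cost_def by simp
      then have card_R: "nat \<lceil>cost (a0, a1, a2, b0, b1, b2)\<rceil> \<le> card R" by linarith
      have RG: "R \<subseteq> G"
        using D(1) pairs_mono[of D0 C] pairs_mono[of "D0 \<union> D1" C] pairs_mono[of "D0 \<union> D1 \<union> D2" C] C_props(2)
        unfolding R_def by blast
      have "G \<in> Bad (a0, a1, a2, b0, b1, b2)"
        unfolding Bad_def prod.case by (rule mem_scheme_event_stagesI[OF D(2-4) R_def RG card_R])
      then show False using G(3) le C(2) by (auto simp: I_def)
    qed
    have "0 \<le> L" "0 \<le> 1 - t" "1 - t \<le> 1 / 2" "0 \<le> t" using t L by auto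
    then obtain p q j where pqj: "p + q + j = card C"
      "real p * (real p - 1) \<le> L * ((1 - t) * p) + 2 * (\<epsilon> / 4 * L\<^sup>2)"
      "(real (card C))\<^sup>2 \<le> L * ((1 - t) * p + q + 2 * j) + real p * q / 2 + 5 * card C + 2 * (\<epsilon> / 4 * L\<^sup>2)"
      "(real (card C))\<^sup>2 \<le> L * ((1 - t) * p + q + 2 * t * j) + real p * q / 2 + 2 * real p * j + real q * j
       + 5 * card C + 2 * L + 2 * (\<epsilon> / 4 * L\<^sup>2)"
      using clique_decomposition[OF finC C_props(1,3) _ _ _ _ few] by blast
    have sum: "real (card C) = real p + real q + real j" using pqj(1) by linarith
    have "real p + real q + real j \<le> 2 * L" using k(3) sum C(2) by simp
    note scaled = clique_scaled_inequalities[OF _ L(2) _ _ _ this pqj(2) pqj(3,4)[unfolded of_nat_mult of_nat_numeral sum]]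
    have "\<kappa> \<le> real p / L + real q / L + real j / L" "real p / L + real q / L + real j / L \<le> \<alpha>"
      using k(1,2) sum C(2) L(1) by (auto simp: field_simps)
    then show False using scaled L(1) by (intro gap[of "real p / L" "real q / L" "real j / L"]) auto
  qed
  then have "measure_pmf.prob (random_graph n) Ev \<le> measure_pmf.prob (random_graph n) (\<Union>\<tau>\<in>I. Bad \<tau>)"
    unfolding prob_random_graph V_def[symmetric]
    by (intro divide_right_mono) (auto intro!: card_mono simp: V_def vertex_pairs_eq_pairs finite_pairs)
  also have "\<dots> \<le> (\<Sum>\<tau>\<in>I. measure_pmf.prob (random_graph n) (Bad \<tau>))"
    by (rule measure_pmf.finite_measure_subadditive_finite) (auto simp: I_def)
  also have "\<dots> \<le> (\<Sum>\<tau>\<in>I. 2 powr (- (\<epsilon> / 4 * L\<^sup>2)))"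
  proof (rule sum_mono)
    fix \<tau> assume "\<tau> \<in> I"
    obtain a0 a1 a2 b0 b1 b2 where \<tau>: "\<tau> = (a0, a1, a2, b0, b1, b2)" by (cases \<tau>)
    have "measure_pmf.prob (random_graph n) (Bad \<tau>) \<le>
      2 powr (log 2 n * ((1 - t) * (a0 + b0) + (1::real) * a1 + b1 + 2 * t * a2 + b2) + b0 - nat \<lceil>cost \<tau>\<rceil>)"
      unfolding \<tau> Bad_def prod.case S_def using n1 Q by (rule prob_stages_le)
    also have "\<dots> \<le> 2 powr (- (\<epsilon> / 4 * L\<^sup>2))"
    proof -
      have "cost \<tau> \<le> nat \<lceil>cost \<tau>\<rceil>" by linarith
      then show ?thesis by (simp add: \<tau> cost_def L_def)
    qed
    finally show "measure_pmf.prob (random_graph n) (Bad \<tau>) \<le> 2 powr (- (\<epsilon> / 4 * L\<^sup>2))" .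
  qed
  also have "\<dots> = (real k + 1) ^ 6 * 2 powr (- (\<epsilon> / 4 * L\<^sup>2))"
    by (simp add: I_def card_cartesian_product numeral_eq_Suc algebra_simps)
  also have "\<dots> \<le> (2 * L + 1) ^ 6 * 2 powr (- (\<epsilon> / 4 * L\<^sup>2))"
    using k(3) by (intro mult_right_mono power_mono) auto
  also have "\<dots> < 1 / 2" using n(5) unfolding L_def .
  finally show False using n(6) unfolding Ev_def S_def L_def by simp
qed

theorem theorem4:
  fixes \<delta> :: real
  assumes "1 \<le> \<delta>" and "\<delta> < 2"
  shows "alpha_star [1 - \<delta> / 2, 1, \<delta>] 3 \<le> 1 + \<delta> / 2"
  unfolding alpha_star_def
proof (rule cSup_least)
  have "clique_algorithm [1 - \<delta> / 2, 1, \<delta>] 3 0 (\<lambda>n h. {})"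
    using assms by (intro exists_trivial_clique_algorithm) (auto simp: less_Suc_eq numeral_eq_Suc)
  then show "{\<alpha>. \<exists>A. clique_algorithm [1 - \<delta> / 2, 1, \<delta>] 3 \<alpha> A} \<noteq> {}" by blast
qed (use assms clique_algorithm_le in blast)

end
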